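(* Let $\mathcal{Q}_\mathrm{con}^{(L)}=\mathcal{Q}_L \circ \cdots \circ \mathcal{Q}_1$ be an $L$-level concatenated code with parameters $[\![N,K,D]\!]$. Suppose that every $\mathcal{Q}_i$ ($i \in [L]$) is an $[\![n_i,k_i,d_i]\!]$ self-dual CSS code with $k_i\ge 1$, constructed from a binary linear code $\mathcal{D}_i$ with $\mathcal{D}_i^\perp\subsetneq\mathcal{D}_i$, such that, writing $\mathcal{D}_i=\langle \mathcal{D}_i^\perp,\mathbf{h}_1,\dots,\mathbf{h}_{k_i}\rangle$, there is $j\in[k_i]$ with $\mathbf{h}_j\cdot\mathbf{h}_j=1$ (equivalently, $\mathcal{Q}_i$ has a compatible symplectic basis), and that the logical Pauli operators of each $\mathcal{Q}_i$ are defined by a compatible symplectic basis. Then, for any $l,m \in \{0,\dots,L\}$ with $m < l$ and for any $j_1 \in [k_1],\dots,j_m\in [k_m],i_{l+1} \in [n_{l+1}],\dots,i_L \in [n_L]$, the following operators are transversal at levels $m,\dots,l$: 1. $U_H^{(l)}\left(\{j_1\},\dots,\{j_m\},[k_{m+1}],\dots,[k_l],\{i_{l+1}\},\dots,\{i_L\}\right)$; 2. $U_S^{(l)}\left(\{j_1\},\dots,\{j_m\},[k_{m+1}],\dots,[k_l],\{i_{l+1}\},\dots,\{i_L\};\mathbf{a}\right)$ for any $\mathbf{a} \in \{1,-1\}^c$, where $c = |\{j_1\} \times \dots \times \{j_m\} \times [k_{m+1}] \times \dots \times [k_l] \times \{i_{l+1}\} \times \dots \times \{i_L\}|$; 3.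 $U_\mathrm{CNOT}^{(l)}\left(\{j_1\},\dots,\{j_m\},[k_{m+1}],\dots,[k_l],\{i_{l+1}\},\dots,\{i_L\}\right)$.
   Context: $[k]=\{1,\dots,k\}$; $\mathbf{a}\cdot\mathbf{b}=\sum_i a_ib_i \pmod 2$ on $\mathbb{Z}_2^n$. Self-dual CSS code: for a binary linear code $\mathcal{D}\subseteq\mathbb{Z}_2^n$ with $\mathcal{D}^\perp\subseteq\mathcal{D}$ and a full-row-rank parity check matrix with rows $\mathbf{g}_1,\dots,\mathbf{g}_r$, it is the stabilizer code whose stabilizer group $S$ is generated by the $X$-type and $Z$-type Pauli operators supported on the supports of the $\mathbf{g}_i$; it encodes $k=n-2r$ logical qubits. A symplectic basis is a set of $k$ pairs $\{(\bar X_j,\bar Z_j)\}_{j\in[k]}$ of Pauli operators commuting with $S$ which together with $S$ and $iI^{\otimes n}$ generate the centralizer $C(S)$ of $S$ in the Pauli group, with $\bar X_j,\bar Z_j$ anticommuting for each $j$ and all other pairs among the $\bar X$'s and $\bar Z$'s commuting. It defines the logical Pauli operators and hence logical gates. Equalities between gates mean equality of the action on the encoded space, up to global phase. With $H_i$ (Hadamard) and $S_i$ (phase gate $\mathrm{diag}(1,i)$) on physical qubits and $\bar H_j,\bar S_j$ on logical qubits, a symplectic basis is compatible (with multilevel transversal Clifford operations) if (i) $\bigotimes_{j=1}^k\bar H_j=\bigotimes_{i=1}^n H_i$; and (ii) for any $(a_1,\dots,a_k)\in\{-1,1\}^k$ there is $(b_1,\dots,b_n)\in\{-1,1\}^n$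 with $\bigotimes_{j=1}^k\bar S_j^{a_j}=\bigotimes_{i=1}^nS_i^{b_i}$. Concatenated code: given $[\![n_i,k_i,d_i]\!]$ stabilizer codes $\mathcal{Q}_i$, $i\in[L]$, the $L$-level concatenated code $\mathcal{Q}_\mathrm{con}^{(L)}=\mathcal{Q}_L\circ\cdots\circ\mathcal{Q}_1$ has $N=\prod_i n_i$ physical qubits and $K=\prod_i k_i$ logical qubits; $D$ is its distance. Logical qubits at the $l$-th level ($l\in\{0,\dots,L\}$) are indexed by $(j_1,\dots,j_l,i_{l+1},\dots,i_L)\in[k_1]\times\cdots\times[k_l]\times[n_{l+1}]\times\cdots\times[n_L]$, so there are $N^{(l)}=\prod_{i\le l}k_i\prod_{j>l}n_j$ of them; level $0$ qubits are the physical qubits, and level $L$ qubits are the logical qubits of $\mathcal{Q}_\mathrm{con}^{(L)}$. For each $l\in[L]$ and each fixed $j_1,\dots,j_{l-1},i_{l+1},\dots,i_L$, the $n_l$ level-$(l-1)$ qubits $(j_1,\dots,j_{l-1},i_l,i_{l+1},\dots,i_L)$, $i_l\in[n_l]$, form a block of $\mathcal{Q}_l$, whose $k_l$ logical qubits are the level-$l$ qubits $(j_1,\dots,j_{l-1},j_l,i_{l+1},\dots,i_L)$, $j_l\in[k_l]$. When two blocks of $\mathcal{Q}_\mathrm{con}^{(L)}$ are considered, the same symplectic bases are used in both. A gate $U^{(l)}$ on one block of $\mathcal{Q}_\mathrm{con}^{(L)}$, acting on the $N^{(l)}$ level-$l$ qubits, is transversal at the $m$-th level if $U^{(l)}=\bigotimes_{i=1}^{N^{(m)}}G_i^{(m)}$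 where $G_i^{(m)}$ is a single-qubit gate on the $i$-th level-$m$ qubit. A gate $V^{(l)}$ on two blocks, acting on the $N^{(l)}$ level-$l$ qubits of each, is transversal at the $m$-th level if $V^{(l)}=\bigotimes_{i=1}^{N^{(m)}}F^{(m)}_{1:i,2:i}$ where $F^{(m)}_{1:i,2:i}$ is a two-qubit gate acting on the $i$-th level-$m$ qubit of the first block and the $i$-th level-$m$ qubit of the second block. For $B_1\subseteq[k_1],\dots,B_l\subseteq[k_l],A_{l+1}\subseteq[n_{l+1}],\dots,A_L\subseteq[n_L]$ put $T=B_1\times\cdots\times B_l\times A_{l+1}\times\cdots\times A_L$. $U_H^{(l)}(B_1,\dots,A_L)$ is the gate on one block applying the level-$l$ Hadamard gate $H^{(l)}$ to each level-$l$ qubit with index in $T$ and the identity to the others. $U_S^{(l)}(B_1,\dots,A_L;\mathbf{a})$, $\mathbf{a}\in\{1,-1\}^{|T|}$, is the gate on one block applying $S^{(l)}$ or $S^{\dagger(l)}$ (for entry $1$ or $-1$ of $\mathbf{a}$, respectively) to each level-$l$ qubit with index in $T$ and the identity to the others. $U_\mathrm{CNOT}^{(l)}(B_1,\dots,A_L)$ is the gate on two blocks applying, for each index in $T$, a level-$l$ CNOT gate with control the level-$l$ qubit of that index in the first block and target the level-$l$ qubit of the same index in the second block, and the identity to the other level-$l$ qubits. *)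

theory Defs
  imports
    "HOL-Library.Z2"
    "HOL-Library.FuncSet"
    "HOL-Algebra.Generated_Groups"
    "Jordan_Normal_Form.DL_Rank"
    "Jordan_Normal_Form.Matrix_Kernel"
begin

section \<open>Operators on registers of qubits\<close>

text \<open>
  A register is a finite set \<open>Q\<close> of qubit labels.  The computational basis state whose
  qubits with value 1 are exactly those in \<open>x \<subseteq> Q\<close> is identified with \<open>x\<close>, so the state space has
  basis \<open>Pow Q\<close>.  For two blocks of the same register the basis is \<open>Pow Q \<times> Pow Q\<close>.
  An operator is its matrix \<open>M row column\<close>; all matrices vanish outside their index sets, so that
  HOL equality is equality of operators.
\<close>

type_synonym ('a, 'b) op = "'a \<Rightarrow> 'b \<Rightarrow> complex"

definition op_mult :: "'b set \<Rightarrow> ('a, 'b) op \<Rightarrow> ('b, 'c) op \<Rightarrow> ('a, 'c) op" where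
  "op_mult B M N = (\<lambda>x z. \<Sum>y\<in>B. M x y * N y z)"

definition op_scale :: "complex \<Rightarrow> ('a, 'b) op \<Rightarrow> ('a, 'b) op" where
  "op_scale c M = (\<lambda>x y. c * M x y)"

type_synonym gate1 = "bool \<Rightarrow> bool \<Rightarrow> complex"
type_synonym gate2 = "bool \<times> bool \<Rightarrow> bool \<times> bool \<Rightarrow> complex"

definition unitary_gate :: "('a::finite \<Rightarrow> 'a \<Rightarrow> complex) \<Rightarrow> bool" where
  "unitary_gate G \<longleftrightarrow> (\<forall>a b. (\<Sum>c\<in>UNIV. cnj (G c a) * G c b) = of_bool (a = b))"

definition gate_I :: gate1 where
  "gate_I a b = of_bool (a = b)"

definition gate_X :: gate1 where
  "gate_X a b = of_bool (a \<noteq> b)"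

definition gate_Z :: gate1 where
  "gate_Z a b = (if a = b then (if a then - 1 else 1) else 0)"

definition gate_Y :: gate1 where
  "gate_Y a b = (if a = b then 0 else if a then \<i> else - \<i>)"

definition gate_H :: gate1 where
  "gate_H a b = (if a \<and> b then - 1 else 1) / complex_of_real (sqrt 2)"

text \<open>The \<open>a\<close>-th power of the phase gate \<open>diag(1, \<i>)\<close>.\<close>

definition gate_S :: "int \<Rightarrow> gate1" where
  "gate_S a = (\<lambda>b c. if b = c then (if b then \<i> powi a else 1) else 0)"

text \<open>The first component is the control, the second the target.\<close>

definition gate_CNOT :: gate2 where
  "gate_CNOT s t = of_bool (fst s = fst t \<and> snd s = (snd t \<noteq> fst t))"

definition tensor1 :: "'q set \<Rightarrow> ('q \<Rightarrow> gate1) \<Rightarrow> ('q set, 'q set) op" where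
  "tensor1 Q G = (\<lambda>x y. if x \<subseteq> Q \<and> y \<subseteq> Q then \<Prod>q\<in>Q. G q (q \<in> x) (q \<in> y) else 0)"

text \<open>Operator on two blocks: \<open>F q\<close> acts on qubit \<open>q\<close> of the first and qubit \<open>q\<close> of the second.\<close>

definition tensor2 ::
    "'q set \<Rightarrow> ('q \<Rightarrow> gate2) \<Rightarrow> ('q set \<times> 'q set, 'q set \<times> 'q set) op" where
  "tensor2 Q F = (\<lambda>(x1, x2) (y1, y2).
     if x1 \<subseteq> Q \<and> x2 \<subseteq> Q \<and> y1 \<subseteq> Q \<and> y2 \<subseteq> Q
     then \<Prod>q\<in>Q. F q (q \<in> x1, q \<in> x2) (q \<in> y1, q \<in> y2) else 0)"

definition kron :: "('a, 'b) op \<Rightarrow> ('c, 'd) op \<Rightarrow> ('a \<times> 'c, 'b \<times> 'd) op" where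
  "kron M N = (\<lambda>(x1, x2) (y1, y2). M x1 y1 * N x2 y2)"

text \<open>
  Let \<open>E\<close> encode states with basis \<open>B\<close> into states with basis \<open>A\<close>.  The operator \<open>W\<close> on
  the latter equals the operator \<open>U\<close> on the encoded states, i.e. its action on the encoded space is
  that of \<open>U\<close> up to a global phase.
\<close>

definition equal_on_encoded ::
    "'a set \<Rightarrow> 'b set \<Rightarrow> ('a, 'b) op \<Rightarrow> ('a, 'a) op \<Rightarrow> ('b, 'b) op \<Rightarrow> bool" where
  "equal_on_encoded A B E W U \<longleftrightarrow>
     (\<exists>c. cmod c = 1 \<and> op_mult A W E = op_scale c (op_mult B E U))"


section \<open>Pauli group and stabilizer codes\<close>

datatype pauli = PI | PX | PY | PZ

fun pauli_gate :: "pauli \<Rightarrow> gate1" where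
  "pauli_gate PI = gate_I"
| "pauli_gate PX = gate_X"
| "pauli_gate PY = gate_Y"
| "pauli_gate PZ = gate_Z"

definition pauli_op :: "'q set \<Rightarrow> nat \<Rightarrow> ('q \<Rightarrow> pauli) \<Rightarrow> ('q set, 'q set) op" where
  "pauli_op Q c \<sigma> = op_scale (\<i> ^ c) (tensor1 Q (\<lambda>q. pauli_gate (\<sigma> q)))"

definition pauli_group :: "'q set \<Rightarrow> ('q set, 'q set) op monoid" where
  "pauli_group Q =
     \<lparr>carrier = {pauli_op Q c \<sigma> | c \<sigma>. True},
      monoid.mult = op_mult (Pow Q),
      one = tensor1 Q (\<lambda>_. gate_I)\<rparr>"

definition phase_generator :: "'q set \<Rightarrow> ('q set, 'q set) op" where
  "phase_generator Q = op_scale \<i> (tensor1 Q (\<lambda>_. gate_I))"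

definition ops_commute ::
    "'q set \<Rightarrow> ('q set, 'q set) op \<Rightarrow> ('q set, 'q set) op \<Rightarrow> bool" where
  "ops_commute Q M N \<longleftrightarrow> op_mult (Pow Q) M N = op_mult (Pow Q) N M"

definition ops_anticommute ::
    "'q set \<Rightarrow> ('q set, 'q set) op \<Rightarrow> ('q set, 'q set) op \<Rightarrow> bool" where
  "ops_anticommute Q M N \<longleftrightarrow> op_mult (Pow Q) M N = op_scale (- 1) (op_mult (Pow Q) N M)"

definition pauli_centralizer ::
    "'q set \<Rightarrow> ('q set, 'q set) op set \<Rightarrow> ('q set, 'q set) op set" where
  "pauli_centralizer Q S = {P \<in> carrier (pauli_group Q). \<forall>s\<in>S. ops_commute Q P s}"

text \<open>Least weight of a Pauli operator in \<open>C(S)\<close> that is not in \<open>S\<close> up to phase.\<close>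

definition code_distance :: "'q set \<Rightarrow> ('q set, 'q set) op set \<Rightarrow> nat" where
  "code_distance Q S =
     (LEAST w. \<exists>c \<sigma>. pauli_op Q c \<sigma> \<in> pauli_centralizer Q S
        \<and> pauli_op Q c \<sigma> \<notin> generate (pauli_group Q) (insert (phase_generator Q) S)
        \<and> w = card {q \<in> Q. \<sigma> q \<noteq> PI})"

definition op_apply :: "'b set \<Rightarrow> ('a, 'b) op \<Rightarrow> ('b \<Rightarrow> complex) \<Rightarrow> 'a \<Rightarrow> complex" where
  "op_apply B M \<psi> = (\<lambda>x. \<Sum>y\<in>B. M x y * \<psi> y)"

definition states :: "'q set \<Rightarrow> ('q set \<Rightarrow> complex) set" where
  "states Q = {\<psi>. \<forall>x. \<not> x \<subseteq> Q \<longrightarrow> \<psi> x = 0}"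

definition code_space :: "'q set \<Rightarrow> ('q set, 'q set) op set \<Rightarrow> ('q set \<Rightarrow> complex) set" where
  "code_space Q S = {\<psi> \<in> states Q. \<forall>s\<in>S. op_apply (Pow Q) s \<psi> = \<psi>}"

text \<open>Stabilizer group of the code with encoding isometry \<open>E\<close> into the register \<open>Q\<close>.\<close>

definition stabilizer_of :: "'q set \<Rightarrow> ('q set, 'b) op \<Rightarrow> ('q set, 'q set) op set" where
  "stabilizer_of Q E = {P \<in> carrier (pauli_group Q). op_mult (Pow Q) P E = E}"


section \<open>Self-dual CSS codes\<close>

definition dual_code :: "nat \<Rightarrow> bit vec set \<Rightarrow> bit vec set" where
  "dual_code n D = {v \<in> carrier_vec n. \<forall>w\<in>D. v \<bullet> w = 0}"

text \<open>Physical qubits are labelled \<open>1..n\<close>, whereas vector coordinates are indexed from 0.\<close>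

definition vec_support :: "nat \<Rightarrow> bit vec \<Rightarrow> nat set" where
  "vec_support n v = {i \<in> {1..n}. v $ (i - 1) = 1}"

definition pauli_on :: "nat \<Rightarrow> pauli \<Rightarrow> bit vec \<Rightarrow> (nat set, nat set) op" where
  "pauli_on n p v = pauli_op {1..n} 0 (\<lambda>i. if i \<in> vec_support n v then p else PI)"

definition css_stabilizer :: "nat \<Rightarrow> bit mat \<Rightarrow> (nat set, nat set) op set" where
  "css_stabilizer n G =
     generate (pauli_group {1..n})
       (pauli_on n PX ` set (rows G) \<union> pauli_on n PZ ` set (rows G))"

text \<open>
  \<open>G\<close> is a parity check matrix of full row rank \<open>r = dim_row G\<close> of the linear code \<open>D\<close>.
\<close>

definition self_dual_css_code ::
    "nat \<Rightarrow> nat \<Rightarrow> nat \<Rightarrow> bit vec set \<Rightarrow> bit mat \<Rightarrow> bool" where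
  "self_dual_css_code n k d D G \<longleftrightarrow>
     dim_col G = n \<and> mat_kernel G = D \<and> vec_space.rank (dim_row G) G = dim_row G
     \<and> dual_code n D \<subseteq> D
     \<and> n = k + 2 * dim_row G
     \<and> d = code_distance {1..n} (css_stabilizer n G)"

definition vec_span :: "nat \<Rightarrow> bit vec set \<Rightarrow> bit vec set" where
  "vec_span n W = LinearCombinations.module.span class_ring (module_vec TYPE(bit) n) W"


section \<open>Symplectic bases and logical gates\<close>

definition symplectic_basis ::
    "nat \<Rightarrow> nat \<Rightarrow> (nat set, nat set) op set \<Rightarrow>
     (nat \<Rightarrow> (nat set, nat set) op) \<Rightarrow> (nat \<Rightarrow> (nat set, nat set) op) \<Rightarrow> bool" where
  "symplectic_basis n k S X Z \<longleftrightarrow>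
     (\<forall>j\<in>{1..k}. X j \<in> pauli_centralizer {1..n} S \<and> Z j \<in> pauli_centralizer {1..n} S)
     \<and> generate (pauli_group {1..n})
         (S \<union> {phase_generator {1..n}} \<union> X ` {1..k} \<union> Z ` {1..k})
       = pauli_centralizer {1..n} S
     \<and> (\<forall>j\<in>{1..k}. ops_anticommute {1..n} (X j) (Z j))
     \<and> (\<forall>i\<in>{1..k}. \<forall>j\<in>{1..k}. ops_commute {1..n} (X i) (X j) \<and> ops_commute {1..n} (Z i) (Z j))
     \<and> (\<forall>i\<in>{1..k}. \<forall>j\<in>{1..k}. i \<noteq> j \<longrightarrow> ops_commute {1..n} (X i) (Z j))"

text \<open>
  The identification \<open>V\<close> of \<open>k\<close> logical qubits with the code space under which the Pauli \<open>X\<close> and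
  \<open>Z\<close> on logical qubit \<open>j\<close> act as \<open>X j\<close> and \<open>Z j\<close>.  These conditions determine \<open>V\<close> up to a global
  phase, and a logical gate is \<open>V U V\<^sup>\<dagger>\<close> on the code space.  Its existence forces the logical Pauli
  operators to be Hermitian, which excludes symplectic pairs carrying factors of \<open>\<i>\<close>.
\<close>

definition logical_encoding ::
    "nat \<Rightarrow> nat \<Rightarrow> (nat set, nat set) op set \<Rightarrow>
     (nat \<Rightarrow> (nat set, nat set) op) \<Rightarrow> (nat \<Rightarrow> (nat set, nat set) op) \<Rightarrow>
     (nat set, nat set) op \<Rightarrow> bool" where
  "logical_encoding n k S X Z V \<longleftrightarrow>
     (\<forall>x y. \<not> (x \<subseteq> {1..n} \<and> y \<subseteq> {1..k}) \<longrightarrow> V x y = 0)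
     \<and> (\<forall>y\<in>Pow {1..k}. \<forall>z\<in>Pow {1..k}.
          (\<Sum>x\<in>Pow {1..n}. cnj (V x y) * V x z) = of_bool (y = z))
     \<and> op_apply (Pow {1..k}) V ` states {1..k} = code_space {1..n} S
     \<and> (\<forall>j\<in>{1..k}.
          op_mult (Pow {1..n}) (X j) V
            = op_mult (Pow {1..k}) V (tensor1 {1..k} (\<lambda>q. if q = j then gate_X else gate_I))
          \<and> op_mult (Pow {1..n}) (Z j) V
            = op_mult (Pow {1..k}) V (tensor1 {1..k} (\<lambda>q. if q = j then gate_Z else gate_I)))"

text \<open>Compatibility with multilevel transversal Clifford operations.\<close>

definition compatible_basis ::
    "nat \<Rightarrow> nat \<Rightarrow> (nat set, nat set) op set \<Rightarrow>
     (nat \<Rightarrow> (nat set, nat set) op) \<Rightarrow> (nat \<Rightarrow> (nat set, nat set) op) \<Rightarrow>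
     (nat set, nat set) op \<Rightarrow> bool" where
  "compatible_basis n k S X Z V \<longleftrightarrow>
     symplectic_basis n k S X Z \<and> logical_encoding n k S X Z V
     \<and> equal_on_encoded (Pow {1..n}) (Pow {1..k}) V
         (tensor1 {1..n} (\<lambda>_. gate_H)) (tensor1 {1..k} (\<lambda>_. gate_H))
     \<and> (\<forall>a \<in> {1..k} \<rightarrow> {- 1, 1}. \<exists>b \<in> {1..n} \<rightarrow> {- 1, 1}.
          equal_on_encoded (Pow {1..n}) (Pow {1..k}) V
            (tensor1 {1..n} (\<lambda>i. gate_S (b i))) (tensor1 {1..k} (\<lambda>j. gate_S (a j))))"


section \<open>Concatenated codes\<close>

text \<open>
  A level-\<open>l\<close> qubit \<open>(j\<^sub>1,\<dots>,j\<^sub>l,i\<^sub>l\<^sub>+\<^sub>1,\<dots>,i\<^sub>L)\<close> is the function on \<open>{1..L}\<close> with these values.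
\<close>

definition index_box ::
    "nat \<Rightarrow> nat \<Rightarrow> (nat \<Rightarrow> nat set) \<Rightarrow> (nat \<Rightarrow> nat set) \<Rightarrow> (nat \<Rightarrow> nat) set" where
  "index_box L l B A = (\<Pi>\<^sub>E p\<in>{1..L}. if p \<le> l then B p else A p)"

definition level_qubits ::
    "nat \<Rightarrow> (nat \<Rightarrow> nat) \<Rightarrow> (nat \<Rightarrow> nat) \<Rightarrow> nat \<Rightarrow> (nat \<Rightarrow> nat) set" where
  "level_qubits L n k l = index_box L l (\<lambda>p. {1..k p}) (\<lambda>p. {1..n p})"

definition level_blocks ::
    "nat \<Rightarrow> (nat \<Rightarrow> nat) \<Rightarrow> (nat \<Rightarrow> nat) \<Rightarrow> nat \<Rightarrow> (nat \<Rightarrow> nat) set" where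
  "level_blocks L n k l = (\<Pi>\<^sub>E p\<in>{1..L} - {l}. if p < l then {1..k p} else {1..n p})"

text \<open>
  Encoding of the level-\<open>l\<close> qubits into the level-\<open>(l - 1)\<close> qubits: the tensor product over all
  blocks of \<open>\<Q>\<^sub>l\<close> of its encoding \<open>V l\<close>.
\<close>

definition block_encoding ::
    "nat \<Rightarrow> (nat \<Rightarrow> nat) \<Rightarrow> (nat \<Rightarrow> nat) \<Rightarrow> (nat \<Rightarrow> (nat set, nat set) op) \<Rightarrow> nat \<Rightarrow>
     ((nat \<Rightarrow> nat) set, (nat \<Rightarrow> nat) set) op" where
  "block_encoding L n k V l = (\<lambda>x y.
     if x \<subseteq> level_qubits L n k (l - 1) \<and> y \<subseteq> level_qubits L n k l
     then \<Prod>f\<in>level_blocks L n k l.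
            V l {i \<in> {1..n l}. f(l := i) \<in> x} {j \<in> {1..k l}. f(l := j) \<in> y}
     else 0)"

text \<open>Encoding of the level-\<open>l\<close> qubits into the level-\<open>m\<close> qubits, for \<open>m \<le> l\<close>.\<close>

primrec encoding ::
    "nat \<Rightarrow> (nat \<Rightarrow> nat) \<Rightarrow> (nat \<Rightarrow> nat) \<Rightarrow> (nat \<Rightarrow> (nat set, nat set) op) \<Rightarrow> nat \<Rightarrow> nat \<Rightarrow>
     ((nat \<Rightarrow> nat) set, (nat \<Rightarrow> nat) set) op" where
  "encoding L n k V m 0 = tensor1 (level_qubits L n k m) (\<lambda>_. gate_I)"
| "encoding L n k V m (Suc l) =
     (if Suc l \<le> m then tensor1 (level_qubits L n k m) (\<lambda>_. gate_I)
      else op_mult (Pow (level_qubits L n k l)) (encoding L n k V m l)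
             (block_encoding L n k V (Suc l)))"

definition concatenated_distance ::
    "nat \<Rightarrow> (nat \<Rightarrow> nat) \<Rightarrow> (nat \<Rightarrow> nat) \<Rightarrow> (nat \<Rightarrow> (nat set, nat set) op) \<Rightarrow> nat" where
  "concatenated_distance L n k V =
     code_distance (level_qubits L n k 0)
       (stabilizer_of (level_qubits L n k 0) (encoding L n k V 0 L))"

text \<open>Transversality at level \<open>m\<close> of a gate on the level-\<open>l\<close> qubits of one or of two blocks.\<close>

definition transversal_one ::
    "nat \<Rightarrow> (nat \<Rightarrow> nat) \<Rightarrow> (nat \<Rightarrow> nat) \<Rightarrow> (nat \<Rightarrow> (nat set, nat set) op) \<Rightarrow> nat \<Rightarrow> nat \<Rightarrow>
     ((nat \<Rightarrow> nat) set, (nat \<Rightarrow> nat) set) op \<Rightarrow> bool" where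
  "transversal_one L n k V l m U \<longleftrightarrow>
     (\<exists>G. (\<forall>q\<in>level_qubits L n k m. unitary_gate (G q))
        \<and> equal_on_encoded (Pow (level_qubits L n k m)) (Pow (level_qubits L n k l))
            (encoding L n k V m l) (tensor1 (level_qubits L n k m) G) U)"

definition transversal_two ::
    "nat \<Rightarrow> (nat \<Rightarrow> nat) \<Rightarrow> (nat \<Rightarrow> nat) \<Rightarrow> (nat \<Rightarrow> (nat set, nat set) op) \<Rightarrow> nat \<Rightarrow> nat \<Rightarrow>
     ((nat \<Rightarrow> nat) set \<times> (nat \<Rightarrow> nat) set, (nat \<Rightarrow> nat) set \<times> (nat \<Rightarrow> nat) set) op \<Rightarrow> bool" where
  "transversal_two L n k V l m U \<longleftrightarrow>
     (\<exists>F. (\<forall>q\<in>level_qubits L n k m. unitary_gate (F q))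
        \<and> equal_on_encoded
            (Pow (level_qubits L n k m) \<times> Pow (level_qubits L n k m))
            (Pow (level_qubits L n k l) \<times> Pow (level_qubits L n k l))
            (kron (encoding L n k V m l) (encoding L n k V m l))
            (tensor2 (level_qubits L n k m) F) U)"

definition U_H ::
    "nat \<Rightarrow> (nat \<Rightarrow> nat) \<Rightarrow> (nat \<Rightarrow> nat) \<Rightarrow> nat \<Rightarrow> (nat \<Rightarrow> nat set) \<Rightarrow> (nat \<Rightarrow> nat set) \<Rightarrow>
     ((nat \<Rightarrow> nat) set, (nat \<Rightarrow> nat) set) op" where
  "U_H L n k l B A =
     tensor1 (level_qubits L n k l) (\<lambda>q. if q \<in> index_box L l B A then gate_H else gate_I)"

definition U_S ::
    "nat \<Rightarrow> (nat \<Rightarrow> nat) \<Rightarrow> (nat \<Rightarrow> nat) \<Rightarrow> nat \<Rightarrow> (nat \<Rightarrow> nat set) \<Rightarrow> (nat \<Rightarrow> nat set) \<Rightarrow>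
     ((nat \<Rightarrow> nat) \<Rightarrow> int) \<Rightarrow> ((nat \<Rightarrow> nat) set, (nat \<Rightarrow> nat) set) op" where
  "U_S L n k l B A a =
     tensor1 (level_qubits L n k l) (\<lambda>q. if q \<in> index_box L l B A then gate_S (a q) else gate_I)"

definition U_CNOT ::
    "nat \<Rightarrow> (nat \<Rightarrow> nat) \<Rightarrow> (nat \<Rightarrow> nat) \<Rightarrow> nat \<Rightarrow> (nat \<Rightarrow> nat set) \<Rightarrow> (nat \<Rightarrow> nat set) \<Rightarrow>
     ((nat \<Rightarrow> nat) set \<times> (nat \<Rightarrow> nat) set, (nat \<Rightarrow> nat) set \<times> (nat \<Rightarrow> nat) set) op" where
  "U_CNOT L n k l B A =
     tensor2 (level_qubits L n k l)
       (\<lambda>q. if q \<in> index_box L l B A then gate_CNOT else (\<lambda>s t. of_bool (s = t)))"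

end

theory Submission
  imports Defs
begin

text \<open>
  The phase condition, applied to two sign vectors that differ on a set \<open>u\<close> of logical qubits, shows
  that the logical \<open>Z\<close> on \<open>u\<close> is, up to a sign, a physical \<open>Z\<close> operator on a set \<open>z u\<close>; conjugation by
  the transversal Hadamard gate gives the logical \<open>X\<close> on \<open>u\<close> as the \<open>X\<close> operator on \<open>z u\<close> with the same
  sign.  As the code space consists of all states fixed by the checks, the logical basis state \<open>{}\<close> is
  supported on a single coset of the group of \<open>X\<close> operators fixing the code, and the other basis states
  are its translates.  Hence the transversal CNOT acts as logical CNOT up to \<open>Z\<close> operators on the first
  and \<open>X\<close> operators on the second block.  The gates \<open>H\<close>, \<open>S\<close>, its inverse, and CNOT with such Pauli
  corrections are therefore each carried from the logical to the physical qubits of every block, and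
  one descends through the levels.
\<close>

section \<open>Symmetric difference and signs\<close>

text \<open>The obstacle is a sign. Let \<gamma> be the function giving, for each \<open>u\<close>,
  the sign relating logical \<open>Z\<close> on \<open>u\<close> to physical \<open>Z\<close> on
  \<open>z u\<close>. It can be negative, so the coset that carries the logical basis state
  \<open>{}\<close> need not contain the physical label \<open>{}\<close>. For a point
  \<open>x0\<close> of that coset, \<open>\<gamma> u\<close> is the parity sign of
  \<open>z u\<close> against \<open>x0\<close>. A transversal CNOT controlled by a label of the
  logical state \<open>y1\<close> therefore translates the second block by \<open>z y1\<close> and
  also by \<open>x0\<close>, and the translation by \<open>z y1\<close> brings in the sign
  \<open>\<gamma> y1\<close>, which depends on the control. \<open>X\<close> on \<open>x0\<close> in
  the second block removes the offset. \<open>Z\<close> on \<open>x0\<close> in the first block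
  removes the sign, because it reads the same sign off the control label up to a constant. These
  corrections become part of the logical gate for the next level down, so the descent runs over a
  class of gates that one level maps into itself, not over a single gate.

  Gates must also stay off the qubits that are not selected. The fixed coordinates lie outside
  \<open>m + 1..l\<close>, and a descent step in this range changes only its own coordinate, so
  every block met on the way is selected either entirely or not at all.\<close>

definition xor_set :: "'a set \<Rightarrow> 'a set \<Rightarrow> 'a set"  (infixl \<open>\<triangle>\<close> 65) where
  "x \<triangle> y = {q. (q \<in> x) \<noteq> (q \<in> y)}"

lemma mem_xor_set [simp]: "q \<in> x \<triangle> y \<longleftrightarrow> (q \<in> x) \<noteq> (q \<in> y)"
  by (simp add: xor_set_def)

lemma xor_set_assoc: "(x \<triangle> y) \<triangle> z = x \<triangle> (y \<triangle> z)"
  and xor_set_commute: "x \<triangle> y = y \<triangle> x"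
  and xor_set_left_commute: "x \<triangle> (y \<triangle> z) = y \<triangle> (x \<triangle> z)"
  by auto

lemmas xor_set_ac = xor_set_assoc xor_set_commute xor_set_left_commute

lemma xor_set_simps [simp]:
  "x \<triangle> {} = x" "{} \<triangle> x = x" "x \<triangle> x = {}" "x \<triangle> (x \<triangle> y) = y" "x \<triangle> y \<triangle> y = x"
  by auto

lemma xor_set_subset [simp]: "x \<subseteq> Q \<Longrightarrow> y \<subseteq> Q \<Longrightarrow> x \<triangle> y \<subseteq> Q"
  by auto

lemma xor_set_subset_iff: "z \<subseteq> Q \<Longrightarrow> x \<triangle> z \<subseteq> Q \<longleftrightarrow> x \<subseteq> Q"
  by (auto simp: subset_iff)

lemma sum_Pow_xor: "z \<subseteq> Q \<Longrightarrow> (\<Sum>x\<in>Pow Q. f (x \<triangle> z)) = (\<Sum>x\<in>Pow Q. f x)"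
  by (rule sum.reindex_bij_witness[where i = "\<lambda>x. x \<triangle> z" and j = "\<lambda>x. x \<triangle> z"]) auto

text \<open>For finite \<open>Q\<close> this is -1 to the power of the size of
  \<open>x \<inter> y \<inter> Q\<close>, the binary inner product written as a sign. It is the
  diagonal entry at \<open>y\<close> of Pauli \<open>Z\<close> on \<open>x\<close> and also, up to
  normalisation, the entry of the Hadamard tensor, so one function serves both gates.\<close>

definition psign :: "'q set \<Rightarrow> 'q set \<Rightarrow> 'q set \<Rightarrow> complex" where
  "psign Q x y = (\<Prod>q\<in>Q. if q \<in> x \<and> q \<in> y then - 1 else 1)"

lemma psign_commute: "psign Q x y = psign Q y x"
  unfolding psign_def by (rule prod.cong) auto

lemma psign_xor_left: "psign Q (x \<triangle> y) z = psign Q x z * psign Q y z"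
  unfolding psign_def prod.distrib[symmetric] by (rule prod.cong) auto

lemma psign_xor_right: "psign Q z (x \<triangle> y) = psign Q z x * psign Q z y"
  by (metis psign_commute psign_xor_left)

lemma psign_square [simp]: "psign Q x y * psign Q x y = 1"
  unfolding psign_def prod.distrib[symmetric] by (rule prod.neutral) auto

lemma psign_square_left [simp]: "psign Q x y * (psign Q x y * c) = c"
  by (simp flip: mult.assoc)

lemma psign_nonzero [simp]: "psign Q x y \<noteq> 0"
  using psign_square[of Q x y] by (auto simp del: psign_square)

lemma psign_cases: "psign Q x y = 1 \<or> psign Q x y = - 1"
  using psign_square[of Q x y] square_eq_1_iff by blast

lemma psign_norm [simp]: "cmod (psign Q x y) = 1"
  using psign_cases[of Q x y] by auto

lemma psign_empty [simp]: "psign Q {} y = 1" "psign Q y {} = 1"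
  by (simp_all add: psign_def)

lemma psign_singleton:
  "finite Q \<Longrightarrow> q \<in> Q \<Longrightarrow> psign Q {q} y = (if q \<in> y then - 1 else 1)"
  unfolding psign_def by (subst prod.remove[of _ q]) (auto intro!: prod.neutral)

text \<open>Orthogonality of characters: if \<open>u\<close> and \<open>v\<close> differ at
  \<open>j\<close>, then flipping \<open>j\<close> in \<open>y\<close> is a bijection of
  \<open>Pow K\<close> that negates every summand, so the sum equals its own negative.\<close>

lemma psign_orthogonal:
  assumes "finite K" "u \<subseteq> K" "v \<subseteq> K"
  shows "(\<Sum>y\<in>Pow K. psign K u y * psign K y v) = (if u = v then 2 ^ card K else 0)"
proof (cases "u = v")
  case True
  have "psign K u y * psign K y v = 1" for y
    using True by (simp add: psign_commute[of K y])
  then show ?thesis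
    using True assms(1) by (simp add: card_Pow)
next
  case False
  then obtain j where j: "j \<in> u \<triangle> v"
    by (auto simp: set_eq_iff)
  then have jK: "j \<in> K"
    using assms by auto
  let ?f = "\<lambda>y. psign K (u \<triangle> v) y"
  have "(\<Sum>y\<in>Pow K. ?f y) = (\<Sum>y\<in>Pow K. ?f (y \<triangle> {j}))"
    using jK by (intro sum_Pow_xor[symmetric]) auto
  also have "\<dots> = - (\<Sum>y\<in>Pow K. ?f y)"
    using psign_singleton[OF assms(1) jK, of "u \<triangle> v"] j
    by (simp only: psign_xor_right psign_commute[of K "u \<triangle> v" "{j}"]) (simp add: sum_negf)
  finally have "(\<Sum>y\<in>Pow K. ?f y) = 0"
    by simp
  then show ?thesis
    using False by (simp add: psign_xor_left psign_commute[of K _ v])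
qed


section \<open>Entries of tensor products\<close>

text \<open>Meant for gates with one nonzero entry in each row: \<open>P\<close> says where it sits
  and \<open>w\<close> gives its value. A single vanishing factor kills the whole product, which
  turns \<open>P\<close> into a condition on all qubits.\<close>

lemma tensor1_monomial:
  assumes "finite Q" and "\<And>q a b. q \<in> Q \<Longrightarrow> G q a b = (if P q a b then w q a else 0)"
  shows "tensor1 Q G x y =
    (if x \<subseteq> Q \<and> y \<subseteq> Q \<and> (\<forall>q\<in>Q. P q (q \<in> x) (q \<in> y)) then \<Prod>q\<in>Q. w q (q \<in> x) else 0)"
  using assms by (auto simp: tensor1_def intro!: prod.cong prod_zero)

lemma tensor1_I:
  "finite Q \<Longrightarrow> tensor1 Q (\<lambda>_. gate_I) x y = (if x \<subseteq> Q \<and> x = y then 1 else 0)"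
  by (subst tensor1_monomial[where P = "\<lambda>_ a b. a = b" and w = "\<lambda>_ _. 1"])
     (auto simp: gate_I_def)

lemma tensor1_H:
  assumes "finite Q" "x \<subseteq> Q" "y \<subseteq> Q"
  shows "tensor1 Q (\<lambda>_. gate_H) x y = psign Q x y / complex_of_real (sqrt 2) ^ card Q"
  using assms by (simp add: tensor1_def gate_H_def psign_def prod_dividef)

lemma tensor1_S:
  assumes "finite Q"
  shows "tensor1 Q (\<lambda>q. gate_S (b q)) x y =
    (if x \<subseteq> Q \<and> x = y then \<Prod>q\<in>Q. if q \<in> x then \<i> powi b q else 1 else 0)"
  using assms
  by (subst tensor1_monomial[where P = "\<lambda>_ a b. a = b" and w = "\<lambda>q a. if a then \<i> powi b q else 1"])
     (auto simp: gate_S_def)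

lemma tensor1_X_on:
  assumes "finite Q" "r \<subseteq> Q"
  shows "tensor1 Q (\<lambda>q. if q \<in> r then gate_X else gate_I) x y =
    (if x \<subseteq> Q \<and> y = x \<triangle> r then 1 else 0)"
  using assms
  by (subst tensor1_monomial[where P = "\<lambda>q a b. b = (a \<noteq> (q \<in> r))" and w = "\<lambda>_ _. 1"])
     (auto simp: gate_X_def gate_I_def subset_iff set_eq_iff)

lemma tensor1_Z_on:
  assumes "finite Q"
  shows "tensor1 Q (\<lambda>q. if q \<in> r then gate_Z else gate_I) x y =
    (if x \<subseteq> Q \<and> y = x then psign Q r x else 0)"
  using assms
  by (subst tensor1_monomial[where P = "\<lambda>q a b. a = b" and w = "\<lambda>q a. if q \<in> r \<and> a then - 1 else 1"])
     (auto simp: gate_Z_def gate_I_def psign_def)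

lemma tensor2_monomial:
  assumes "finite Q" and "\<And>q s t. q \<in> Q \<Longrightarrow> F q s t = (if P q s t then w q s else 0)"
  shows "tensor2 Q F (x1, x2) (y1, y2) =
    (if x1 \<subseteq> Q \<and> x2 \<subseteq> Q \<and> y1 \<subseteq> Q \<and> y2 \<subseteq> Q
        \<and> (\<forall>q\<in>Q. P q (q \<in> x1, q \<in> x2) (q \<in> y1, q \<in> y2))
     then \<Prod>q\<in>Q. w q (q \<in> x1, q \<in> x2) else 0)"
  using assms by (auto simp: tensor2_def intro!: prod.cong prod_zero)

lemma tensor2_I:
  assumes "finite Q"
  shows "tensor2 Q (\<lambda>_ s t. of_bool (s = t)) (x1, x2) (y1, y2) =
    (if x1 \<subseteq> Q \<and> x2 \<subseteq> Q \<and> y1 = x1 \<and> y2 = x2 then 1 else 0)"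
  using assms
  by (subst tensor2_monomial[where P = "\<lambda>_ s t. s = t" and w = "\<lambda>_ _. 1"]) auto

section \<open>Matrix algebra of operators and composition of encodings\<close>

lemma op_mult_assoc: "op_mult C (op_mult B M N) R = op_mult B M (op_mult C N R)"
proof (intro ext)
  fix x z
  have "op_mult C (op_mult B M N) R x z = (\<Sum>c\<in>C. \<Sum>b\<in>B. M x b * N b c * R c z)"
    by (simp add: op_mult_def sum_distrib_right)
  also have "\<dots> = (\<Sum>b\<in>B. \<Sum>c\<in>C. M x b * N b c * R c z)"
    by (rule sum.swap)
  also have "\<dots> = op_mult B M (op_mult C N R) x z"
    by (simp add: op_mult_def sum_distrib_left mult.assoc)
  finally show "op_mult C (op_mult B M N) R x z = op_mult B M (op_mult C N R) x z" .
qed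

lemma op_mult_scale:
  "op_mult B (op_scale c M) N = op_scale c (op_mult B M N)"
  "op_mult B M (op_scale c N) = op_scale c (op_mult B M N)"
  by (simp_all add: op_mult_def op_scale_def sum_distrib_left mult_ac)

lemma op_scale_scale: "op_scale a (op_scale b M) = op_scale (a * b) M"
  by (simp add: op_scale_def mult_ac)

lemma op_apply_mult: "op_apply C (op_mult B M N) \<psi> = op_apply B M (op_apply C N \<psi>)"
proof
  fix x
  show "op_apply C (op_mult B M N) \<psi> x = op_apply B M (op_apply C N \<psi>) x"
    unfolding op_apply_def op_mult_def
    by (simp add: sum_distrib_left sum_distrib_right mult.assoc) (rule sum.swap)
qed

lemma op_mult_I_left:
  assumes "finite Q" "\<And>x y. \<not> x \<subseteq> Q \<Longrightarrow> M x y = 0"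
  shows "op_mult (Pow Q) (tensor1 Q (\<lambda>_. gate_I)) M = M"
proof (intro ext)
  fix x y
  have "(\<Sum>z\<in>Pow Q. tensor1 Q (\<lambda>_. gate_I) x z * M z y) =
        (\<Sum>z\<in>Pow Q. if z = x then M x y else 0)"
    using assms(1) by (intro sum.cong) (auto simp: tensor1_I)
  then show "op_mult (Pow Q) (tensor1 Q (\<lambda>_. gate_I)) M x y = M x y"
    using assms by (auto simp: op_mult_def)
qed

lemma op_mult_I_right:
  assumes "finite Q" "\<And>x y. \<not> y \<subseteq> Q \<Longrightarrow> M x y = 0"
  shows "op_mult (Pow Q) M (tensor1 Q (\<lambda>_. gate_I)) = M"
proof (intro ext)
  fix x y
  have "(\<Sum>z\<in>Pow Q. M x z * tensor1 Q (\<lambda>_. gate_I) z y) =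
        (\<Sum>z\<in>Pow Q. if z = y then M x y else 0)"
    using assms(1) by (intro sum.cong) (auto simp: tensor1_I)
  then show "op_mult (Pow Q) M (tensor1 Q (\<lambda>_. gate_I)) x y = M x y"
    using assms by (auto simp: op_mult_def)
qed

text \<open>\<open>U'\<close> is logical for \<open>E1\<close> and physical for \<open>E2\<close>.
  Associativity lets it pass from one side to the other, and the two global phases multiply.\<close>

lemma equal_on_encoded_comp:
  assumes "equal_on_encoded A B E1 W U'" "equal_on_encoded B C E2 U' U"
  shows "equal_on_encoded A C (op_mult B E1 E2) W U"
proof -
  obtain c1 c2 where c: "cmod c1 = 1" "op_mult A W E1 = op_scale c1 (op_mult B E1 U')"
      "cmod c2 = 1" "op_mult B U' E2 = op_scale c2 (op_mult C E2 U)"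
    using assms unfolding equal_on_encoded_def by blast
  have "op_mult A W (op_mult B E1 E2) = op_mult B (op_mult A W E1) E2"
    by (simp add: op_mult_assoc)
  also have "\<dots> = op_scale (c1 * c2) (op_mult C (op_mult B E1 E2) U)"
    by (simp add: c op_mult_scale op_mult_assoc op_scale_scale)
  finally show ?thesis
    unfolding equal_on_encoded_def using c by (intro exI[of _ "c1 * c2"]) (simp add: norm_mult)
qed


section \<open>The stabilizer conditions on amplitudes\<close>

lemma op_apply_I:
  assumes "finite Q" "\<psi> \<in> states Q"
  shows "op_apply (Pow Q) (tensor1 Q (\<lambda>_. gate_I)) \<psi> = \<psi>"
proof
  fix x
  have "(\<Sum>z\<in>Pow Q. tensor1 Q (\<lambda>_. gate_I) x z * \<psi> z) =
        (\<Sum>z\<in>Pow Q. if z = x then \<psi> x else 0)"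
    using assms(1) by (intro sum.cong) (auto simp: tensor1_I)
  then show "op_apply (Pow Q) (tensor1 Q (\<lambda>_. gate_I)) \<psi> x = \<psi> x"
    using assms by (auto simp: op_apply_def states_def)
qed

lemma pauli_group_outside:
  assumes "P \<in> carrier (pauli_group Q)" "\<not> (x \<subseteq> Q \<and> y \<subseteq> Q)"
  shows "P x y = 0"
proof -
  obtain c \<sigma> where "P = pauli_op Q c \<sigma>"
    using assms(1) by (auto simp: pauli_group_def)
  moreover have "tensor1 Q g x y = 0" for g
    unfolding tensor1_def by (rule if_not_P[OF assms(2)])
  ultimately show ?thesis
    by (simp add: pauli_op_def op_scale_def)
qed

text \<open>\<open>generate\<close> closes under \<open>m_inv\<close>, which is a definite
  description. Its uniqueness is checked directly here, without a group structure on
  \<open>pauli_group\<close>: any inverse \<open>R\<close> of \<open>P\<close> satisfies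
  \<open>R = R P P = P\<close>.\<close>

lemma pauli_group_inv_involution:
  assumes "finite Q" "P \<in> carrier (pauli_group Q)"
    and "op_mult (Pow Q) P P = tensor1 Q (\<lambda>_. gate_I)"
  shows "m_inv (pauli_group Q) P = P"
  unfolding m_inv_def
proof (rule the_equality)
  show "P \<in> carrier (pauli_group Q) \<and> P \<otimes>\<^bsub>pauli_group Q\<^esub> P = \<one>\<^bsub>pauli_group Q\<^esub>
      \<and> P \<otimes>\<^bsub>pauli_group Q\<^esub> P = \<one>\<^bsub>pauli_group Q\<^esub>"
    using assms by (auto simp: pauli_group_def)
next
  fix R
  assume R: "R \<in> carrier (pauli_group Q) \<and> P \<otimes>\<^bsub>pauli_group Q\<^esub> R = \<one>\<^bsub>pauli_group Q\<^esub>
      \<and> R \<otimes>\<^bsub>pauli_group Q\<^esub> P = \<one>\<^bsub>pauli_group Q\<^esub>"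
  then have RP: "op_mult (Pow Q) R P = tensor1 Q (\<lambda>_. gate_I)"
    by (simp add: pauli_group_def)
  have "R = op_mult (Pow Q) R (op_mult (Pow Q) P P)"
    using assms R pauli_group_outside by (metis op_mult_I_right)
  also have "\<dots> = op_mult (Pow Q) (op_mult (Pow Q) R P) P"
    by (simp add: op_mult_assoc)
  also have "\<dots> = P"
    unfolding RP using assms pauli_group_outside by (metis op_mult_I_left)
  finally show "R = P" .
qed

text \<open>The generators are involutions, so their inverses bring nothing new, and a product fixes
  \<psi> because each factor does.\<close>

lemma generate_stabilizes:
  assumes "finite Q" "\<psi> \<in> states Q" "S \<subseteq> carrier (pauli_group Q)"
    and "\<And>P. P \<in> S \<Longrightarrow> op_mult (Pow Q) P P = tensor1 Q (\<lambda>_. gate_I)"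
    and "\<And>P. P \<in> S \<Longrightarrow> op_apply (Pow Q) P \<psi> = \<psi>"
    and "P \<in> generate (pauli_group Q) S"
  shows "op_apply (Pow Q) P \<psi> = \<psi>"
  using assms(6)
proof induction
  case one
  then show ?case
    using assms by (simp add: pauli_group_def op_apply_I)
next
  case (inv P)
  then show ?case
    using assms by (subst pauli_group_inv_involution) auto
next
  case (eng P R)
  then show ?case
    by (simp add: pauli_group_def op_apply_mult)
qed (use assms in auto)

lemma pauli_op_on:
  "pauli_op Q 0 (\<lambda>i. if i \<in> r then p else PI) =
   tensor1 Q (\<lambda>q. if q \<in> r then pauli_gate p else gate_I)"
  by (auto simp: pauli_op_def op_scale_def if_distrib cong: if_cong)

lemma op_apply_X_on:
  assumes "finite Q" "r \<subseteq> Q" "x \<subseteq> Q"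
  shows "op_apply (Pow Q) (tensor1 Q (\<lambda>q. if q \<in> r then gate_X else gate_I)) \<psi> x = \<psi> (x \<triangle> r)"
proof -
  have "op_apply (Pow Q) (tensor1 Q (\<lambda>q. if q \<in> r then gate_X else gate_I)) \<psi> x =
      (\<Sum>y\<in>Pow Q. if y = x \<triangle> r then \<psi> (x \<triangle> r) else 0)"
    unfolding op_apply_def using assms by (intro sum.cong) (auto simp: tensor1_X_on)
  then show ?thesis
    using assms by simp
qed

lemma op_apply_Z_on:
  assumes "finite Q" "x \<subseteq> Q"
  shows "op_apply (Pow Q) (tensor1 Q (\<lambda>q. if q \<in> r then gate_Z else gate_I)) \<psi> x = psign Q r x * \<psi> x"
proof -
  have "op_apply (Pow Q) (tensor1 Q (\<lambda>q. if q \<in> r then gate_Z else gate_I)) \<psi> x =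
      (\<Sum>y\<in>Pow Q. if y = x then psign Q r x * \<psi> x else 0)"
    unfolding op_apply_def using assms by (intro sum.cong) (auto simp: tensor1_Z_on)
  then show ?thesis
    using assms by simp
qed

lemma op_apply_outside:
  "\<not> x \<subseteq> Q \<Longrightarrow> op_apply (Pow Q) (tensor1 Q G) \<psi> x = 0"
  by (simp add: op_apply_def tensor1_def)

lemma X_on_involution:
  assumes "finite Q" "r \<subseteq> Q"
  shows "op_mult (Pow Q) (tensor1 Q (\<lambda>q. if q \<in> r then gate_X else gate_I))
      (tensor1 Q (\<lambda>q. if q \<in> r then gate_X else gate_I)) = tensor1 Q (\<lambda>_. gate_I)"
proof (intro ext)
  fix x z
  let ?M = "tensor1 Q (\<lambda>q. if q \<in> r then gate_X else gate_I)"
  show "op_mult (Pow Q) ?M ?M x z = tensor1 Q (\<lambda>_. gate_I) x z"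
  proof (cases "x \<subseteq> Q")
    case True
    then have "op_mult (Pow Q) ?M ?M x z = ?M (x \<triangle> r) z"
      using op_apply_X_on[OF assms True, of "\<lambda>y. ?M y z"] by (simp add: op_apply_def op_mult_def)
    then show ?thesis
      using True assms by (auto simp: tensor1_X_on tensor1_I)
  qed (simp add: op_mult_def tensor1_def)
qed

lemma Z_on_involution:
  assumes "finite Q"
  shows "op_mult (Pow Q) (tensor1 Q (\<lambda>q. if q \<in> r then gate_Z else gate_I))
      (tensor1 Q (\<lambda>q. if q \<in> r then gate_Z else gate_I)) = tensor1 Q (\<lambda>_. gate_I)"
proof (intro ext)
  fix x z
  let ?M = "tensor1 Q (\<lambda>q. if q \<in> r then gate_Z else gate_I)"
  show "op_mult (Pow Q) ?M ?M x z = tensor1 Q (\<lambda>_. gate_I) x z"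
  proof (cases "x \<subseteq> Q")
    case True
    then have "op_mult (Pow Q) ?M ?M x z = psign Q r x * ?M x z"
      using op_apply_Z_on[OF assms True, of r "\<lambda>y. ?M y z"] by (simp add: op_apply_def op_mult_def)
    then show ?thesis
      using True assms by (auto simp: tensor1_Z_on tensor1_I)
  qed (simp add: op_mult_def tensor1_def)
qed

definition check_supports :: "nat \<Rightarrow> bit mat \<Rightarrow> nat set set" where
  "check_supports n G = vec_support n ` set (rows G)"

text \<open>This trades the stabilizer group for pointwise conditions on amplitudes. An
  \<open>X\<close> generator demands invariance under translation by \<open>r\<close>, and a
  \<open>Z\<close> generator allows only labels meeting \<open>r\<close> in an even number of
  qubits.\<close>

lemma code_space_css_iff:
  "\<psi> \<in> code_space {1..n} (css_stabilizer n G) \<longleftrightarrow> \<psi> \<in> states {1..n} \<and>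
    (\<forall>r\<in>check_supports n G. \<forall>x. x \<subseteq> {1..n} \<longrightarrow> \<psi> (x \<triangle> r) = \<psi> x \<and> psign {1..n} r x * \<psi> x = \<psi> x)"
  (is "?L \<longleftrightarrow> ?st \<and> ?R")
proof -
  let ?Q = "{1..n}"
  let ?X = "\<lambda>r. tensor1 ?Q (\<lambda>q. if q \<in> r then gate_X else gate_I)"
  let ?Z = "\<lambda>r. tensor1 ?Q (\<lambda>q. if q \<in> r then gate_Z else gate_I)"
  let ?gen = "?X ` check_supports n G \<union> ?Z ` check_supports n G"
  have S: "css_stabilizer n G = generate (pauli_group ?Q) ?gen"
    by (simp add: css_stabilizer_def pauli_on_def[abs_def] pauli_op_on check_supports_def image_image
        cong: if_cong)
  have sub: "r \<subseteq> ?Q" if "r \<in> check_supports n G" for r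
    using that by (auto simp: check_supports_def vec_support_def)
  have carrier: "?gen \<subseteq> carrier (pauli_group ?Q)"
  proof -
    have "?X r = pauli_op ?Q 0 (\<lambda>i. if i \<in> r then PX else PI)"
      "?Z r = pauli_op ?Q 0 (\<lambda>i. if i \<in> r then PZ else PI)" for r
      by (simp_all add: pauli_op_on cong: if_cong)
    then show ?thesis
      unfolding pauli_group_def by auto
  qed
  have invol: "op_mult (Pow ?Q) P P = tensor1 ?Q (\<lambda>_. gate_I)" if "P \<in> ?gen" for P
    using that sub by (auto simp: X_on_involution Z_on_involution)
  have gen_iff: "(\<forall>P\<in>?gen. op_apply (Pow ?Q) P \<psi> = \<psi>) \<longleftrightarrow> ?R" if st: "\<psi> \<in> states ?Q"
  proof -
    have eq_iff: "op_apply (Pow ?Q) (tensor1 ?Q g) \<psi> = \<psi> \<longleftrightarrow>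
        (\<forall>x. x \<subseteq> ?Q \<longrightarrow> op_apply (Pow ?Q) (tensor1 ?Q g) \<psi> x = \<psi> x)" for g
    proof (intro iffI ext)
      fix x
      assume "\<forall>x. x \<subseteq> ?Q \<longrightarrow> op_apply (Pow ?Q) (tensor1 ?Q g) \<psi> x = \<psi> x"
      then show "op_apply (Pow ?Q) (tensor1 ?Q g) \<psi> x = \<psi> x"
        using st by (cases "x \<subseteq> ?Q") (simp_all add: op_apply_outside states_def)
    qed simp
    have X: "op_apply (Pow ?Q) (?X r) \<psi> = \<psi> \<longleftrightarrow> (\<forall>x. x \<subseteq> ?Q \<longrightarrow> \<psi> (x \<triangle> r) = \<psi> x)"
      if "r \<in> check_supports n G" for r
      unfolding eq_iff using sub[OF that] by (simp add: op_apply_X_on)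
    have Z: "op_apply (Pow ?Q) (?Z r) \<psi> = \<psi> \<longleftrightarrow>
        (\<forall>x. x \<subseteq> ?Q \<longrightarrow> psign ?Q r x * \<psi> x = \<psi> x)" for r
      unfolding eq_iff by (simp add: op_apply_Z_on)
    have "(\<forall>P\<in>?gen. op_apply (Pow ?Q) P \<psi> = \<psi>) \<longleftrightarrow>
        (\<forall>r\<in>check_supports n G. op_apply (Pow ?Q) (?X r) \<psi> = \<psi> \<and> op_apply (Pow ?Q) (?Z r) \<psi> = \<psi>)"
      unfolding ball_Un ball_simps ball_conj_distrib ..
    also have "\<dots> \<longleftrightarrow> ?R"
      by (intro ball_cong refl) (simp only: X Z all_conj_distrib imp_conjR)
    finally show ?thesis .
  qed
  show ?thesis
  proof
    assume ?L
    then have st: "\<psi> \<in> states ?Q"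
      and fixed: "\<And>P. P \<in> generate (pauli_group ?Q) ?gen \<Longrightarrow> op_apply (Pow ?Q) P \<psi> = \<psi>"
      unfolding code_space_def S by simp_all
    have "\<forall>P\<in>?gen. op_apply (Pow ?Q) P \<psi> = \<psi>"
      by (intro ballI fixed generate.incl)
    with st show "?st \<and> ?R"
      unfolding gen_iff[OF st] by (intro conjI)
  next
    assume "?st \<and> ?R"
    note st = conjunct1[OF this] and checks = conjunct2[OF this]
    have fixed: "\<forall>P\<in>?gen. op_apply (Pow ?Q) P \<psi> = \<psi>"
      unfolding gen_iff[OF st] by (rule checks)
    show ?L
      unfolding code_space_def S
      using generate_stabilizes[OF finite_atLeastAtMost st carrier invol bspec[OF fixed]] st by simp
  qed
qed


section \<open>Amplitudes of a compatible encoding\<close>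

lemma op_mult_S_left:
  assumes "finite Q" "x \<subseteq> Q"
  shows "op_mult (Pow Q) (tensor1 Q (\<lambda>q. gate_S (b q))) M x y =
    (\<Prod>q\<in>Q. if q \<in> x then \<i> powi b q else 1) * M x y"
proof -
  have "op_mult (Pow Q) (tensor1 Q (\<lambda>q. gate_S (b q))) M x y =
      (\<Sum>x'\<in>Pow Q. if x' = x then (\<Prod>q\<in>Q. if q \<in> x then \<i> powi b q else 1) * M x y else 0)"
    unfolding op_mult_def using assms by (intro sum.cong refl) (simp add: tensor1_S)
  then show ?thesis
    using assms by simp
qed

lemma op_mult_S_right:
  assumes "finite Q" "y \<subseteq> Q"
  shows "op_mult (Pow Q) M (tensor1 Q (\<lambda>q. gate_S (b q))) x y =
    M x y * (\<Prod>q\<in>Q. if q \<in> y then \<i> powi b q else 1)"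
proof -
  have "op_mult (Pow Q) M (tensor1 Q (\<lambda>q. gate_S (b q))) x y =
      (\<Sum>y'\<in>Pow Q. if y' = y then M x y * (\<Prod>q\<in>Q. if q \<in> y then \<i> powi b q else 1) else 0)"
    unfolding op_mult_def using assms by (intro sum.cong refl) (simp add: tensor1_S)
  then show ?thesis
    using assms by simp
qed

text \<open>The phase gate is its inverse times Pauli \<open>Z\<close>. Reversing signs of phase
  gates thus inserts a \<open>Z\<close> exactly where the two sign vectors differ.\<close>

lemma phase_prod_flip:
  assumes "b \<in> Q \<rightarrow> {- 1, 1}" "b' \<in> Q \<rightarrow> {- 1, 1}"
  shows "(\<Prod>q\<in>Q. if q \<in> x then \<i> powi b q else 1) =
    psign Q {q \<in> Q. b q \<noteq> b' q} x * (\<Prod>q\<in>Q. if q \<in> x then \<i> powi b' q else 1)"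
  unfolding psign_def prod.distrib[symmetric]
proof (rule prod.cong)
  fix q
  assume q: "q \<in> Q"
  then have "b q = - 1 \<or> b q = 1" "b' q = - 1 \<or> b' q = 1"
    using assms by blast+
  with q show "(if q \<in> x then \<i> powi b q else 1) =
      (if q \<in> {q \<in> Q. b q \<noteq> b' q} \<and> q \<in> x then - 1 else 1) * (if q \<in> x then \<i> powi b' q else 1)"
    by (auto simp: power_int_minus)
qed simp

lemma phase_prod_nonzero: "finite Q \<Longrightarrow> (\<Prod>q\<in>Q. if q \<in> x then \<i> powi b q else 1) \<noteq> 0"
  by (auto simp: power_int_eq_0_iff)

text \<open>
  \<open>R\<close> consists of the supports of the parity checks; \<open>X\<close>- and \<open>Z\<close>-type operators on
  them generate the stabilizer of the image of \<open>V\<close>.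
\<close>

locale compatible_encoding =
  fixes Q K :: "'q set" and R :: "'q set set" and V :: "('q set, 'q set) op"
  assumes finite_Q [simp]: "finite Q" and finite_K [simp]: "finite K"
    and vanish: "\<And>x y. \<not> (x \<subseteq> Q \<and> y \<subseteq> K) \<Longrightarrow> V x y = 0"
    and column_nonzero: "\<And>y. y \<subseteq> K \<Longrightarrow> \<exists>x. V x y \<noteq> 0"
    and check_subset: "\<And>r. r \<in> R \<Longrightarrow> r \<subseteq> Q"
    and check_X: "\<And>r x y. r \<in> R \<Longrightarrow> x \<subseteq> Q \<Longrightarrow> y \<subseteq> K \<Longrightarrow> V (x \<triangle> r) y = V x y"
    and check_Z: "\<And>r x y. r \<in> R \<Longrightarrow> x \<subseteq> Q \<Longrightarrow> y \<subseteq> K \<Longrightarrow> psign Q r x * V x y = V x y"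
    and encoded: "\<And>\<psi>. \<psi> \<in> states Q \<Longrightarrow>
      (\<And>r x. r \<in> R \<Longrightarrow> x \<subseteq> Q \<Longrightarrow> \<psi> (x \<triangle> r) = \<psi> x \<and> psign Q r x * \<psi> x = \<psi> x) \<Longrightarrow>
      \<exists>\<xi>. \<psi> = op_apply (Pow K) V \<xi>"
    and hadamard: "equal_on_encoded (Pow Q) (Pow K) V (tensor1 Q (\<lambda>_. gate_H)) (tensor1 K (\<lambda>_. gate_H))"
    and phase: "\<And>a. a \<in> K \<rightarrow> {- 1, 1} \<Longrightarrow> \<exists>b \<in> Q \<rightarrow> {- 1, 1}.
      equal_on_encoded (Pow Q) (Pow K) V (tensor1 Q (\<lambda>q. gate_S (b q))) (tensor1 K (\<lambda>q. gate_S (a q)))"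
begin

text \<open>The Hadamard condition moves one transform past \<open>V\<close>. Since the Hadamard
  matrix is its own inverse up to a scalar, applying the logical transform once more recovers
  \<open>V\<close>, so \<open>V\<close> is proportional to its own two-sided Fourier transform. The
  same constant serves all entries, hence it cancels whenever two entries are compared.\<close>

lemma fourier:
  obtains c where "\<And>x y. x \<subseteq> Q \<Longrightarrow> y \<subseteq> K \<Longrightarrow>
    V x y = c * (\<Sum>x'\<in>Pow Q. \<Sum>y'\<in>Pow K. psign Q x x' * V x' y' * psign K y' y)"
proof -
  define s where "s = complex_of_real (sqrt 2)"
  have s: "s \<noteq> 0"
    by (simp add: s_def)
  obtain c where c: "cmod c = 1" and eq: "op_mult (Pow Q) (tensor1 Q (\<lambda>_. gate_H)) V =
      op_scale c (op_mult (Pow K) V (tensor1 K (\<lambda>_. gate_H)))"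
    using hadamard unfolding equal_on_encoded_def by blast
  have row: "(\<Sum>x'\<in>Pow Q. psign Q x x' * V x' y') =
      s ^ card Q * c / s ^ card K * (\<Sum>y''\<in>Pow K. V x y'' * psign K y'' y')"
    if "x \<subseteq> Q" "y' \<subseteq> K" for x y'
  proof -
    have "(\<Sum>x'\<in>Pow Q. psign Q x x' * V x' y') / s ^ card Q =
        op_mult (Pow Q) (tensor1 Q (\<lambda>_. gate_H)) V x y'"
      unfolding op_mult_def sum_divide_distrib using that
      by (intro sum.cong) (simp_all add: tensor1_H s_def)
    also have "\<dots> = op_scale c (op_mult (Pow K) V (tensor1 K (\<lambda>_. gate_H))) x y'"
      by (simp only: eq)
    also have "\<dots> = c * (\<Sum>y''\<in>Pow K. V x y'' * psign K y'' y') / s ^ card K"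
      unfolding op_scale_def op_mult_def sum_divide_distrib sum_distrib_left using that
      by (intro sum.cong) (simp_all add: tensor1_H s_def)
    finally show ?thesis
      using s by (simp add: field_simps)
  qed
  have inv: "(\<Sum>x'\<in>Pow Q. \<Sum>y'\<in>Pow K. psign Q x x' * V x' y' * psign K y' y) =
      s ^ card Q * c / s ^ card K * 2 ^ card K * V x y" if "x \<subseteq> Q" "y \<subseteq> K" for x y
  proof -
    have "(\<Sum>x'\<in>Pow Q. \<Sum>y'\<in>Pow K. psign Q x x' * V x' y' * psign K y' y) =
        (\<Sum>y'\<in>Pow K. (\<Sum>x'\<in>Pow Q. psign Q x x' * V x' y') * psign K y' y)"
      by (subst sum.swap) (simp add: sum_distrib_right)
    also have "\<dots> = (\<Sum>y'\<in>Pow K. s ^ card Q * c / s ^ card K *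
        (\<Sum>y''\<in>Pow K. V x y'' * psign K y'' y') * psign K y' y)"
      using row that by (intro sum.cong) auto
    also have "\<dots> = s ^ card Q * c / s ^ card K *
        (\<Sum>y'\<in>Pow K. \<Sum>y''\<in>Pow K. V x y'' * (psign K y'' y' * psign K y' y))"
      by (simp add: sum_distrib_left sum_distrib_right mult_ac)
    also have "(\<Sum>y'\<in>Pow K. \<Sum>y''\<in>Pow K. V x y'' * (psign K y'' y' * psign K y' y)) =
        (\<Sum>y''\<in>Pow K. V x y'' * (\<Sum>y'\<in>Pow K. psign K y'' y' * psign K y' y))"
      by (subst sum.swap) (simp add: sum_distrib_left)
    also have "\<dots> = (\<Sum>y''\<in>Pow K. if y'' = y then V x y * 2 ^ card K else 0)"
      using that by (intro sum.cong) (auto simp: psign_orthogonal)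
    also have "\<dots> = 2 ^ card K * V x y"
      using that by simp
    finally show ?thesis
      by (simp add: mult_ac)
  qed
  \<comment> \<open>Collects the two Hadamard normalisations, the global phase, and the factor
    \<open>2 ^ card K\<close> from character orthogonality. It is nonzero and can be divided
    out.\<close>
  define d where "d = s ^ card Q * c / s ^ card K * 2 ^ card K"
  have d: "d \<noteq> 0"
    using s c by (auto simp: d_def)
  have "V x y = 1 / d * (\<Sum>x'\<in>Pow Q. \<Sum>y'\<in>Pow K. psign Q x x' * V x' y' * psign K y' y)"
    if "x \<subseteq> Q" "y \<subseteq> K" for x y
    unfolding inv[OF that] d_def[symmetric] using d by simp
  then show thesis
    by (rule that)
qed

text \<open>The Fourier transform exchanges multiplication by a character with translation. This is
  the Hadamard conjugation of \<open>Z\<close> on \<open>z\<close> into \<open>X\<close> on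
  \<open>z\<close>, done on both sides of the encoding, and it leaves the factor \<gamma>
  unchanged.\<close>

lemma shift_of_sign:
  assumes "z \<subseteq> Q" "u \<subseteq> K"
    and sgn: "\<And>x y. x \<subseteq> Q \<Longrightarrow> y \<subseteq> K \<Longrightarrow> psign Q z x * V x y = \<gamma> * psign K u y * V x y"
    and "x \<subseteq> Q" "y \<subseteq> K"
  shows "V (x \<triangle> z) y = \<gamma> * V x (y \<triangle> u)"
proof -
  obtain c where V: "\<And>x y. x \<subseteq> Q \<Longrightarrow> y \<subseteq> K \<Longrightarrow>
      V x y = c * (\<Sum>x'\<in>Pow Q. \<Sum>y'\<in>Pow K. psign Q x x' * V x' y' * psign K y' y)"
    using fourier by blast
  have "V (x \<triangle> z) y = c * (\<Sum>x'\<in>Pow Q. \<Sum>y'\<in>Pow K. psign Q (x \<triangle> z) x' * V x' y' * psign K y' y)"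
    using assms by (intro V) auto
  also have "(\<Sum>x'\<in>Pow Q. \<Sum>y'\<in>Pow K. psign Q (x \<triangle> z) x' * V x' y' * psign K y' y) =
      (\<Sum>x'\<in>Pow Q. \<Sum>y'\<in>Pow K. \<gamma> * (psign Q x x' * V x' y' * psign K y' (y \<triangle> u)))"
  proof (intro sum.cong refl)
    fix x' y'
    assume "x' \<in> Pow Q" "y' \<in> Pow K"
    then have "psign Q z x' * V x' y' = \<gamma> * psign K u y' * V x' y'"
      using sgn by simp
    then show "psign Q (x \<triangle> z) x' * V x' y' * psign K y' y =
        \<gamma> * (psign Q x x' * V x' y' * psign K y' (y \<triangle> u))"
      by (simp add: psign_xor_left psign_xor_right psign_commute[of K y' u] mult_ac)
  qed
  also have "c * \<dots> = \<gamma> * V x (y \<triangle> u)"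
    using V[of x "y \<triangle> u"] assms by (simp add: sum_distrib_left mult_ac)
  finally show ?thesis .
qed

text \<open>The same duality in the other direction: if \<open>X\<close> on \<open>z\<close> fixes
  the encoded states, then so does \<open>Z\<close> on \<open>z\<close>.\<close>

lemma sign_of_invariance:
  assumes "z \<subseteq> Q" "\<And>x y. x \<subseteq> Q \<Longrightarrow> y \<subseteq> K \<Longrightarrow> V (x \<triangle> z) y = V x y"
    and "x \<subseteq> Q" "y \<subseteq> K"
  shows "psign Q z x * V x y = V x y"
proof -
  obtain c where V: "\<And>x y. x \<subseteq> Q \<Longrightarrow> y \<subseteq> K \<Longrightarrow>
      V x y = c * (\<Sum>x'\<in>Pow Q. \<Sum>y'\<in>Pow K. psign Q x x' * V x' y' * psign K y' y)"
    using fourier by blast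
  define f where "f x' = (\<Sum>y'\<in>Pow K. psign Q x x' * V x' y' * psign K y' y)" for x'
  have "psign Q z x * V x y = c * (\<Sum>x'\<in>Pow Q. psign Q z x * f x')"
    using V[OF assms(3,4)] by (simp add: f_def sum_distrib_left mult_ac)
  also have "(\<Sum>x'\<in>Pow Q. psign Q z x * f x') = (\<Sum>x'\<in>Pow Q. f (x' \<triangle> z))"
    unfolding f_def sum_distrib_left using assms
    by (intro sum.cong refl) (simp add: psign_xor_right psign_commute[of Q z x] mult_ac)
  also have "\<dots> = (\<Sum>x'\<in>Pow Q. f x')"
    using assms(1) by (rule sum_Pow_xor)
  also have "c * \<dots> = V x y"
    using V[OF assms(3,4)] by (simp add: f_def)
  finally show ?thesis .
qed

text \<open>
  Flipping the signs of the logical phase gates on \<open>u\<close> multiplies both sides of the phase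
  condition by Pauli \<open>Z\<close> operators, so the logical \<open>Z\<close> on \<open>u\<close> is a physical \<open>Z\<close> operator up to
  a sign; the Hadamard condition turns it into the corresponding statement for \<open>X\<close>.
\<close>

lemma logical_pauli:
  assumes u: "u \<subseteq> K"
  shows "\<exists>z \<gamma>. z \<subseteq> Q \<and> \<gamma> * \<gamma> = 1
    \<and> (\<forall>x y. V x y \<noteq> 0 \<longrightarrow> psign Q z x = \<gamma> * psign K u y)
    \<and> (\<forall>x y. x \<subseteq> Q \<longrightarrow> y \<subseteq> K \<longrightarrow> V (x \<triangle> z) y = \<gamma> * V x (y \<triangle> u))"
proof -
  define p where "p A x b = (\<Prod>q\<in>A. if q \<in> x then \<i> powi b q else 1)" for A x :: "'q set" and b
  \<comment> \<open>Both phase operators are diagonal, so at a nonzero entry of \<open>V\<close> the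
    phase condition compares two diagonal entries and \<open>V x y\<close> cancels.\<close>
  have entry: "\<exists>b c. b \<in> Q \<rightarrow> {- 1, 1} \<and> c \<noteq> 0 \<and> (\<forall>x y. V x y \<noteq> 0 \<longrightarrow> p Q x b = c * p K y a)"
    if a: "a \<in> K \<rightarrow> {- 1, 1}" for a
  proof -
    obtain b c where b: "b \<in> Q \<rightarrow> {- 1, 1}" and c: "cmod c = 1"
      and eq: "op_mult (Pow Q) (tensor1 Q (\<lambda>q. gate_S (b q))) V =
        op_scale c (op_mult (Pow K) V (tensor1 K (\<lambda>q. gate_S (a q))))"
      using phase[OF a] unfolding equal_on_encoded_def by blast
    have "p Q x b = c * p K y a" if "V x y \<noteq> 0" for x y
    proof -
      have "x \<subseteq> Q" "y \<subseteq> K"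
        using that vanish by blast+
      then have "p Q x b * V x y = c * (V x y * p K y a)"
        using fun_cong[OF fun_cong[OF eq, of x], of y]
        by (simp add: op_mult_S_left op_mult_S_right op_scale_def p_def)
      then show ?thesis
        using that by (simp add: mult_ac)
    qed
    then show ?thesis
      using b c by (intro exI[of _ b] exI[of _ c]) auto
  qed
  define a where "a j = (if j \<in> u then - 1 else 1 :: int)" for j
  have a: "(\<lambda>_. 1) \<in> K \<rightarrow> {- 1, 1 :: int}" "a \<in> K \<rightarrow> {- 1, 1}"
    by (auto simp: a_def)
  obtain b c where b: "b \<in> Q \<rightarrow> {- 1, 1}" "c \<noteq> 0"
      "\<And>x y. V x y \<noteq> 0 \<Longrightarrow> p Q x b = c * p K y (\<lambda>_. 1)"
    using entry[OF a(1)] by blast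
  obtain b' c' where b': "b' \<in> Q \<rightarrow> {- 1, 1}" "c' \<noteq> 0"
      "\<And>x y. V x y \<noteq> 0 \<Longrightarrow> p Q x b' = c' * p K y a"
    using entry[OF a(2)] by blast
  \<comment> \<open>\<open>z\<close> is where the physical sign vectors for the two logical choices
    disagree. The factor \<gamma> below is the quotient of the two global phases; that it is a sign
    is shown only afterwards.\<close>
  define z where "z = {q \<in> Q. b q \<noteq> b' q}"
  define \<gamma> where "\<gamma> = c / c'"
  have zQ: "z \<subseteq> Q"
    by (auto simp: z_def)
  have sgn: "psign Q z x = \<gamma> * psign K u y" if nz: "V x y \<noteq> 0" for x y
  proof -
    have "{j \<in> K. (1::int) \<noteq> a j} = u"
      using u by (auto simp: a_def)
    then have flip: "p K y (\<lambda>_. 1) = psign K u y * p K y a"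
      using phase_prod_flip[OF a, of y] by (simp add: p_def)
    have "p Q x b = psign Q z x * p Q x b'"
      using phase_prod_flip[OF b(1) b'(1), of x] by (simp add: p_def z_def)
    then have "psign Q z x * (c' * p K y a) = c * (psign K u y * p K y a)"
      unfolding b(3)[OF nz] b'(3)[OF nz] flip by (rule sym)
    moreover have "p K y a \<noteq> 0"
      unfolding p_def by (rule phase_prod_nonzero) simp
    ultimately have "psign Q z x * c' = c * psign K u y"
      by (metis mult.assoc mult_right_cancel)
    then show ?thesis
      using b'(2) by (simp add: \<gamma>_def field_simps)
  qed
  \<comment> \<open>At a label in the support of column \<open>{}\<close> the logical sign is 1, so
    \<gamma> equals a value of \<open>psign\<close> and squares to 1.\<close>
  obtain x0 where x0: "V x0 {} \<noteq> 0"
    using column_nonzero by blast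
  have "\<gamma> * \<gamma> = 1"
    using sgn[OF x0] psign_square[of Q z x0] by simp
  moreover have "V (x \<triangle> z) y = \<gamma> * V x (y \<triangle> u)" if "x \<subseteq> Q" "y \<subseteq> K" for x y
    using zQ u that sgn by (intro shift_of_sign) (metis mult_zero_right)+
  ultimately show ?thesis
    using zQ sgn by blast
qed

text \<open>The supports of those \<open>X\<close> operators that act trivially on the encoded
  states. Describing them by invariance, instead of as the span of \<open>R\<close>, avoids linear
  algebra on the parity checks.\<close>

definition invariants :: "'q set set" where
  "invariants = {c. c \<subseteq> Q \<and> (\<forall>x y. x \<subseteq> Q \<longrightarrow> y \<subseteq> K \<longrightarrow> V (x \<triangle> c) y = V x y)}"

lemma invariantsD:
  "c \<in> invariants \<Longrightarrow> c \<subseteq> Q"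
  "c \<in> invariants \<Longrightarrow> x \<subseteq> Q \<Longrightarrow> y \<subseteq> K \<Longrightarrow> V (x \<triangle> c) y = V x y"
  by (auto simp: invariants_def)

lemma invariants_xor:
  assumes "c \<in> invariants" "d \<in> invariants"
  shows "c \<triangle> d \<in> invariants"
proof -
  have "V (x \<triangle> (c \<triangle> d)) y = V x y" if "x \<subseteq> Q" "y \<subseteq> K" for x y
    using that assms invariantsD[of c] invariantsD[of d] by (simp flip: xor_set_assoc)
  then show ?thesis
    using assms by (simp add: invariants_def)
qed

lemma check_invariant: "r \<in> R \<Longrightarrow> r \<in> invariants"
  using check_subset check_X by (simp add: invariants_def)

text \<open>Translation by \<open>c\<close> keeps a label in the support of column
  \<open>{}\<close>, where the sign of \<open>z\<close> is constant. Hence \<open>c\<close> meets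
  \<open>z\<close> in an even number of qubits.\<close>

lemma invariant_orthogonal:
  assumes "c \<in> invariants" "\<And>x y. V x y \<noteq> 0 \<Longrightarrow> psign Q z x = \<gamma> y"
  shows "psign Q z c = 1"
proof -
  obtain x where x: "V x {} \<noteq> 0"
    using column_nonzero by blast
  then have "x \<subseteq> Q"
    using vanish by blast
  then have "V (x \<triangle> c) {} \<noteq> 0"
    using x assms(1) by (simp add: invariantsD)
  then have "psign Q z (x \<triangle> c) = psign Q z x"
    using assms(2) x by metis
  then show ?thesis
    by (simp add: psign_xor_right)
qed

text \<open>The logical \<open>Z\<close> on each singleton is a physical sign, so a label in the
  support of a column determines every bit of that column's index. Different columns have disjoint
  supports.\<close>

lemma row_support_unique:
  assumes "V x y \<noteq> 0" "V x y' \<noteq> 0"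
  shows "y = y'"
proof -
  have K: "y \<subseteq> K" "y' \<subseteq> K"
    using assms vanish by blast+
  have "j \<in> y \<longleftrightarrow> j \<in> y'" if j: "j \<in> K" for j
  proof -
    obtain z \<gamma> where "\<gamma> * \<gamma> = 1" "\<And>x y. V x y \<noteq> 0 \<Longrightarrow> psign Q z x = \<gamma> * psign K {j} y"
      using logical_pauli[of "{j}"] j by auto
    then have "psign K {j} y = psign K {j} y'"
      using assms by (metis mult_cancel_left mult_zero_left zero_neq_one)
    then show ?thesis
      using j by (auto simp: psign_singleton split: if_splits)
  qed
  then show ?thesis
    using K by blast
qed

text \<open>
  The uniform superposition over the coset of \<open>x0\<close> is an encoded state with the logical
  \<open>Z\<close> eigenvalues of the column \<open>{}\<close>, hence a multiple of that column.
\<close>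

lemma zero_column_support:
  assumes x0: "V x0 {} \<noteq> 0" and x: "V x {} \<noteq> 0"
  shows "x \<triangle> x0 \<in> invariants"
proof (rule ccontr)
  assume not_inv: "x \<triangle> x0 \<notin> invariants"
  have Q: "x0 \<subseteq> Q" "x \<subseteq> Q"
    using assms vanish by blast+
  define \<psi> :: "'q set \<Rightarrow> complex" where "\<psi> w = (if w \<triangle> x0 \<in> invariants then 1 else 0)" for w
  have "\<psi> w = 0" if "\<not> w \<subseteq> Q" for w
    using that xor_set_subset_iff[OF Q(1), of w] invariantsD(1)[of "w \<triangle> x0"] by (metis \<psi>_def)
  then have "\<psi> \<in> states Q"
    by (simp add: states_def)
  moreover have "\<psi> (w \<triangle> r) = \<psi> w \<and> psign Q r w * \<psi> w = \<psi> w" if r: "r \<in> R" and w: "w \<subseteq> Q" for r w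
  proof
    have "w \<triangle> r \<triangle> x0 \<in> invariants \<longleftrightarrow> w \<triangle> x0 \<in> invariants"
      using invariants_xor[OF _ check_invariant[OF r], of "w \<triangle> x0"]
        invariants_xor[OF _ check_invariant[OF r], of "w \<triangle> r \<triangle> x0"]
      by (auto simp: xor_set_ac)
    then show "\<psi> (w \<triangle> r) = \<psi> w"
      by (simp add: \<psi>_def)
    have supp: "psign Q r v = 1" if "V v y \<noteq> 0" for v y
      using that check_Z[OF r, of v y] vanish[of v y] by auto
    \<comment> \<open>Here \<open>w\<close> is \<open>x0\<close> translated by an invariant set. The
      sign of \<open>r\<close> is trivial on \<open>x0\<close> because \<open>x0\<close> lies in the
      support of a column, and on the translation by \<open>invariant_orthogonal\<close>.\<close>
    have "psign Q r w = 1" if "w \<triangle> x0 \<in> invariants"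
      using invariant_orthogonal[OF that supp] supp[OF x0] by (simp add: psign_xor_right)
    then show "psign Q r w * \<psi> w = \<psi> w"
      by (simp add: \<psi>_def)
  qed
  ultimately obtain \<xi> where \<xi>: "\<psi> = op_apply (Pow K) V \<xi>"
    using encoded by blast
  \<comment> \<open>On a row in the support of column \<open>{}\<close>, disjointness of supports
    kills all other terms of the expansion. One coefficient \<open>\<xi> {}\<close> must then give
    both 1 at \<open>x0\<close> and 0 at \<open>x\<close>, although \<open>V\<close> is nonzero at
    both.\<close>
  have \<psi>_eq: "\<psi> w = V w {} * \<xi> {}" if "V w {} \<noteq> 0" for w
  proof -
    have "\<psi> w = (\<Sum>y\<in>Pow K. if y = {} then V w {} * \<xi> {} else 0)"
      unfolding \<xi> op_apply_def using that row_support_unique by (intro sum.cong) auto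
    then show ?thesis
      by simp
  qed
  have "\<psi> x0 = 1" "\<psi> x = 0"
    using not_inv by (simp_all add: \<psi>_def invariants_def)
  then show False
    using \<psi>_eq x0 x by fastforce
qed

end


section \<open>Transversal CNOT on one code\<close>

text \<open>
  CNOT followed by \<open>Z\<close> on the first qubit if \<open>a\<close> and \<open>X\<close> on the second if \<open>b\<close>.  The
  corrections cannot be avoided: compatibility fixes the logical Paulis only up to sign.
\<close>

definition pauli_CNOT :: "bool \<Rightarrow> bool \<Rightarrow> gate2" where
  "pauli_CNOT a b s t =
     (if fst s = fst t \<and> snd t = ((fst s \<noteq> snd s) \<noteq> b) then (if a \<and> fst s then - 1 else 1) else 0)"

lemma gate_CNOT_eq: "gate_CNOT = pauli_CNOT False False"
  by (auto simp: gate_CNOT_def pauli_CNOT_def fun_eq_iff)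

lemma tensor2_pauli_CNOT:
  assumes "finite Q" "\<beta> \<subseteq> Q"
  shows "tensor2 Q (\<lambda>q. pauli_CNOT (q \<in> \<alpha>) (q \<in> \<beta>)) (x1, x2) (y1, y2) =
    (if x1 \<subseteq> Q \<and> x2 \<subseteq> Q \<and> y1 = x1 \<and> y2 = x1 \<triangle> x2 \<triangle> \<beta> then psign Q \<alpha> x1 else 0)"
proof -
  have "tensor2 Q (\<lambda>q. pauli_CNOT (q \<in> \<alpha>) (q \<in> \<beta>)) (x1, x2) (y1, y2) =
    (if x1 \<subseteq> Q \<and> x2 \<subseteq> Q \<and> y1 \<subseteq> Q \<and> y2 \<subseteq> Q
        \<and> (\<forall>q\<in>Q. (q \<in> x1) = (q \<in> y1) \<and> (q \<in> y2) = (((q \<in> x1) \<noteq> (q \<in> x2)) \<noteq> (q \<in> \<beta>)))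
     then psign Q \<alpha> x1 else 0)"
  proof -
    have entry: "pauli_CNOT (q \<in> \<alpha>) (q \<in> \<beta>) s t =
        (if fst s = fst t \<and> snd t = ((fst s \<noteq> snd s) \<noteq> (q \<in> \<beta>))
         then if q \<in> \<alpha> \<and> fst s then - 1 else 1 else 0)" for q s t
      by (simp only: pauli_CNOT_def)
    show ?thesis
      unfolding psign_def
      using tensor2_monomial[where F = "\<lambda>q. pauli_CNOT (q \<in> \<alpha>) (q \<in> \<beta>)"
          and P = "\<lambda>q s t. fst s = fst t \<and> snd t = ((fst s \<noteq> snd s) \<noteq> (q \<in> \<beta>))"
          and w = "\<lambda>q s. if q \<in> \<alpha> \<and> fst s then - 1 else 1"
          and ?x1.0 = x1 and ?x2.0 = x2 and ?y1.0 = y1 and ?y2.0 = y2, OF assms(1) entry]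
      by (simp only: fst_conv snd_conv)
  qed
  moreover have "(x1 \<subseteq> Q \<and> x2 \<subseteq> Q \<and> y1 \<subseteq> Q \<and> y2 \<subseteq> Q
        \<and> (\<forall>q\<in>Q. (q \<in> x1) = (q \<in> y1) \<and> (q \<in> y2) = (((q \<in> x1) \<noteq> (q \<in> x2)) \<noteq> (q \<in> \<beta>)))) \<longleftrightarrow>
      x1 \<subseteq> Q \<and> x2 \<subseteq> Q \<and> y1 = x1 \<and> y2 = x1 \<triangle> x2 \<triangle> \<beta>"
    (is "?L \<longleftrightarrow> ?R")
  proof
    assume ?L
    then have sub: "x1 \<subseteq> Q" "x2 \<subseteq> Q" "y1 \<subseteq> Q" "y2 \<subseteq> Q"
      and y1: "\<And>q. q \<in> Q \<Longrightarrow> (q \<in> x1) = (q \<in> y1)"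
      and y2: "\<And>q. q \<in> Q \<Longrightarrow> (q \<in> y2) = (((q \<in> x1) \<noteq> (q \<in> x2)) \<noteq> (q \<in> \<beta>))"
      by simp_all
    have "y2 \<subseteq> Q" "x1 \<triangle> x2 \<triangle> \<beta> \<subseteq> Q"
      using sub assms(2) by simp_all
    moreover have "q \<in> y2 \<longleftrightarrow> q \<in> x1 \<triangle> x2 \<triangle> \<beta>" if "q \<in> Q" for q
      unfolding y2[OF that] by simp
    ultimately have "y2 = x1 \<triangle> x2 \<triangle> \<beta>"
      by (meson subset_antisym subset_iff)
    moreover have "y1 = x1"
      using y1 sub(1,3) by (meson subset_antisym subset_iff)
    ultimately show ?R
      using sub by (intro conjI)
  next
    assume R: ?R
    then have "x1 \<subseteq> Q" "x2 \<subseteq> Q" "y1 = x1" "y2 = x1 \<triangle> x2 \<triangle> \<beta>"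
      by simp_all
    then show ?L
      using assms(2) by simp
  qed
  ultimately show ?thesis
    by simp
qed

lemma tensor2_pauli_CNOT_left:
  assumes "finite Q" "\<beta> \<subseteq> Q" "x1 \<subseteq> Q" "x2 \<subseteq> Q"
  shows "op_mult (Pow Q \<times> Pow Q) (tensor2 Q (\<lambda>q. pauli_CNOT (q \<in> \<alpha>) (q \<in> \<beta>))) (kron V V) (x1, x2) (y1, y2) =
    psign Q \<alpha> x1 * (V x1 y1 * V (x1 \<triangle> x2 \<triangle> \<beta>) y2)"
proof -
  let ?p = "(x1, x1 \<triangle> x2 \<triangle> \<beta>)"
  have "op_mult (Pow Q \<times> Pow Q) (tensor2 Q (\<lambda>q. pauli_CNOT (q \<in> \<alpha>) (q \<in> \<beta>))) (kron V V) (x1, x2) (y1, y2) =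
      (\<Sum>p\<in>Pow Q \<times> Pow Q. if p = ?p then psign Q \<alpha> x1 * (V x1 y1 * V (x1 \<triangle> x2 \<triangle> \<beta>) y2) else 0)"
    unfolding op_mult_def
  proof (intro sum.cong refl)
    fix p
    assume "p \<in> Pow Q \<times> Pow Q"
    then show "tensor2 Q (\<lambda>q. pauli_CNOT (q \<in> \<alpha>) (q \<in> \<beta>)) (x1, x2) p * kron V V p (y1, y2) =
        (if p = ?p then psign Q \<alpha> x1 * (V x1 y1 * V (x1 \<triangle> x2 \<triangle> \<beta>) y2) else 0)"
      using assms by (cases p) (simp add: tensor2_pauli_CNOT kron_def)
  qed
  then show ?thesis
    using assms by simp
qed

lemma tensor2_pauli_CNOT_right:
  assumes "finite K" "\<beta> \<subseteq> K" "y1 \<subseteq> K" "y2 \<subseteq> K"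
  shows "op_mult (Pow K \<times> Pow K) (kron V V) (tensor2 K (\<lambda>q. pauli_CNOT (q \<in> \<alpha>) (q \<in> \<beta>))) (x1, x2) (y1, y2) =
    psign K \<alpha> y1 * (V x1 y1 * V x2 (y1 \<triangle> y2 \<triangle> \<beta>))"
proof -
  let ?p = "(y1, y1 \<triangle> y2 \<triangle> \<beta>)"
  have "op_mult (Pow K \<times> Pow K) (kron V V) (tensor2 K (\<lambda>q. pauli_CNOT (q \<in> \<alpha>) (q \<in> \<beta>))) (x1, x2) (y1, y2) =
      (\<Sum>p\<in>Pow K \<times> Pow K. if p = ?p then psign K \<alpha> y1 * (V x1 y1 * V x2 (y1 \<triangle> y2 \<triangle> \<beta>)) else 0)"
    unfolding op_mult_def
  proof (intro sum.cong refl)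
    fix p
    assume "p \<in> Pow K \<times> Pow K"
    then obtain w1 w2 where p: "p = (w1, w2)" "w1 \<subseteq> K" "w2 \<subseteq> K"
      by blast
    have eq: "y2 = y1 \<triangle> w2 \<triangle> \<beta> \<longleftrightarrow> w2 = y1 \<triangle> y2 \<triangle> \<beta>"
      using xor_set_ac xor_set_simps by metis
    have "tensor2 K (\<lambda>q. pauli_CNOT (q \<in> \<alpha>) (q \<in> \<beta>)) p (y1, y2) =
        (if p = ?p then psign K \<alpha> y1 else 0)"
    proof (cases "w1 = y1")
      case True
      then show ?thesis
        unfolding p(1) tensor2_pauli_CNOT[OF assms(1,2)] using p(2,3) eq by simp
    next
      case False
      then show ?thesis
        unfolding p(1) tensor2_pauli_CNOT[OF assms(1,2)] by simp
    qed
    then show "kron V V (x1, x2) p * tensor2 K (\<lambda>q. pauli_CNOT (q \<in> \<alpha>) (q \<in> \<beta>)) p (y1, y2) =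
        (if p = ?p then psign K \<alpha> y1 * (V x1 y1 * V x2 (y1 \<triangle> y2 \<triangle> \<beta>)) else 0)"
      by (cases "p = ?p") (simp_all add: kron_def)
  qed
  then show ?thesis
    using assms by simp
qed

context compatible_encoding
begin

lemma invariant_sign:
  assumes "c \<in> invariants" "V x y \<noteq> 0"
  shows "psign Q c x = 1"
proof -
  have "x \<subseteq> Q" "y \<subseteq> K"
    using vanish assms(2) by blast+
  then have "psign Q c x * V x y = V x y"
    using sign_of_invariance[OF invariantsD(1)[OF assms(1)] invariantsD(2)[OF assms(1)]] by blast
  then show ?thesis
    using assms(2) by simp
qed

text \<open>Wherever \<open>V x1 y1\<close> is nonzero, \<open>x1\<close> is
  \<open>x0 \<triangle> z y1\<close> up to an invariant set. With \<open>x0\<close> included in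
  \<open>\<beta>'\<close>, the second block is translated by
  \<open>z y1 \<triangle> z \<beta>\<close> up to that set, which is the logical translation by
  \<open>y1 \<triangle> \<beta>\<close> times two signs. With \<open>x0\<close> included in
  \<open>\<alpha>'\<close>, the sign depending on \<open>y1\<close> disappears, and the global phase
  \<open>c\<close> remains.\<close>

lemma transversal_pauli_CNOT:
  assumes \<alpha>: "\<alpha> \<subseteq> K" and \<beta>: "\<beta> \<subseteq> K"
  shows "\<exists>\<alpha>' \<beta>'. equal_on_encoded (Pow Q \<times> Pow Q) (Pow K \<times> Pow K) (kron V V)
    (tensor2 Q (\<lambda>q. pauli_CNOT (q \<in> \<alpha>') (q \<in> \<beta>'))) (tensor2 K (\<lambda>q. pauli_CNOT (q \<in> \<alpha>) (q \<in> \<beta>)))"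
proof -
  define rep where "rep u z \<gamma> \<longleftrightarrow> z \<subseteq> Q \<and> \<gamma> * \<gamma> = 1
    \<and> (\<forall>x y. V x y \<noteq> 0 \<longrightarrow> psign Q z x = \<gamma> * psign K u y)
    \<and> (\<forall>x y. x \<subseteq> Q \<longrightarrow> y \<subseteq> K \<longrightarrow> V (x \<triangle> z) y = \<gamma> * V x (y \<triangle> u))" for u z \<gamma>
  have "\<exists>z \<gamma>. rep u z \<gamma>" if "u \<subseteq> K" for u
    unfolding rep_def using that by (rule logical_pauli)
  then obtain z \<gamma> where rep: "\<And>u. u \<subseteq> K \<Longrightarrow> rep u (z u) (\<gamma> u)"
    by metis
  have z: "z u \<subseteq> Q" and \<gamma>: "\<gamma> u * \<gamma> u = 1" if "u \<subseteq> K" for u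
    using rep[OF that] unfolding rep_def by blast+
  have sgn: "psign Q (z u) x = \<gamma> u * psign K u y" if "u \<subseteq> K" "V x y \<noteq> 0" for u x y
    using rep[OF that(1)] that unfolding rep_def by blast
  have shift: "V (x \<triangle> z u) y = \<gamma> u * V x (y \<triangle> u)" if "u \<subseteq> K" "x \<subseteq> Q" "y \<subseteq> K" for u x y
    using rep[OF that(1)] that unfolding rep_def by blast
  obtain x0 where x0: "V x0 {} \<noteq> 0"
    using column_nonzero by blast
  then have x0Q: "x0 \<subseteq> Q"
    using vanish by blast
  define \<alpha>' where "\<alpha>' = x0 \<triangle> z \<alpha>"
  define \<beta>' where "\<beta>' = x0 \<triangle> z \<beta>"
  define c where "c = \<gamma> \<alpha> * \<gamma> \<beta> * psign Q x0 x0"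
  have \<beta>'Q: "\<beta>' \<subseteq> Q"
    using x0Q z \<beta> by (simp add: \<beta>'_def)
  have c: "cmod c = 1"
  proof -
    have "cmod (\<gamma> u) = 1" if "u \<subseteq> K" for u
    proof -
      have "\<gamma> u = 1 \<or> \<gamma> u = - 1"
        using \<gamma>[OF that] square_eq_1_iff by blast
      then show ?thesis
        by auto
    qed
    then show ?thesis
      using \<alpha> \<beta> by (simp add: c_def norm_mult)
  qed
  \<comment> \<open>\<open>X\<close> on \<open>z y\<close> carries column \<open>y\<close> to column
    \<open>{}\<close> up to sign, so the description of the support of column \<open>{}\<close>
    covers all columns.\<close>
  have coset: "x \<triangle> z y \<triangle> x0 \<in> invariants" if "V x y \<noteq> 0" for x y
  proof -
    have "x \<subseteq> Q" "y \<subseteq> K"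
      using that vanish by blast+
    then have "V (x \<triangle> z y) {} = \<gamma> y * V x y" "\<gamma> y \<noteq> 0"
      using shift[of y x "{}"] \<gamma>[of y] by auto
    then show ?thesis
      using zero_column_support[OF x0] that by simp
  qed
  have key: "psign Q \<alpha>' x1 * (V x1 y1 * V (x1 \<triangle> x2 \<triangle> \<beta>') y2) =
      c * (psign K \<alpha> y1 * (V x1 y1 * V x2 (y1 \<triangle> y2 \<triangle> \<beta>)))"
    if Q: "x1 \<subseteq> Q" "x2 \<subseteq> Q" and K: "y1 \<subseteq> K" "y2 \<subseteq> K" for x1 x2 y1 y2
  proof (cases "V x1 y1 = 0")
    case False
    let ?d = "x1 \<triangle> z y1 \<triangle> x0"
    have d: "?d \<in> invariants"
      using False by (rule coset)
    have shift2: "V (x1 \<triangle> x2 \<triangle> \<beta>') y2 = \<gamma> y1 * \<gamma> \<beta> * V x2 (y1 \<triangle> y2 \<triangle> \<beta>)"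
    proof -
      have "V (x1 \<triangle> x2 \<triangle> \<beta>') y2 = V (x2 \<triangle> z y1 \<triangle> z \<beta> \<triangle> ?d) y2"
        by (rule arg_cong[where f = "\<lambda>x. V x y2"]) (simp add: \<beta>'_def xor_set_ac)
      also have "\<dots> = V (x2 \<triangle> z y1 \<triangle> z \<beta>) y2"
        using d Q K z[OF K(1)] z[OF \<beta>] by (intro invariantsD(2)) simp_all
      also have "\<dots> = \<gamma> \<beta> * (\<gamma> y1 * V x2 (y2 \<triangle> \<beta> \<triangle> y1))"
        using Q K z[OF K(1)] z[OF \<beta>] \<beta> by (simp add: shift)
      also have "y2 \<triangle> \<beta> \<triangle> y1 = y1 \<triangle> y2 \<triangle> \<beta>"
        by (simp add: xor_set_ac)
      finally show ?thesis
        by (simp add: mult_ac)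
    qed
    \<comment> \<open>Evaluating the sign of \<open>z y1\<close> at \<open>x0\<close> gives
      \<open>\<gamma> y1\<close>. Replacing \<open>z y1\<close> by \<open>x1 \<triangle> x0\<close>,
      up to an invariant set of trivial sign, shows that \<open>Z\<close> on \<open>x0\<close>
      measures \<open>\<gamma> y1\<close> from the control label.\<close>
    have \<gamma>_eq: "\<gamma> y1 = psign Q x0 x1 * psign Q x0 x0"
    proof -
      have "\<gamma> y1 = psign Q (z y1) x0"
        using sgn[OF K(1) x0] by simp
      also have "z y1 = x1 \<triangle> x0 \<triangle> ?d"
        by (simp add: xor_set_ac)
      finally show ?thesis
        using invariant_sign[OF d x0] by (simp add: psign_xor_left psign_commute[of Q x1 x0])
    qed
    have "psign Q \<alpha>' x1 = psign Q x0 x1 * (\<gamma> \<alpha> * psign K \<alpha> y1)"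
      using sgn[OF \<alpha> False] by (simp add: \<alpha>'_def psign_xor_left)
    then show ?thesis
      unfolding shift2 \<gamma>_eq c_def by (simp add: mult_ac)
  qed simp
  let ?W = "tensor2 Q (\<lambda>q. pauli_CNOT (q \<in> \<alpha>') (q \<in> \<beta>'))"
  let ?U = "tensor2 K (\<lambda>q. pauli_CNOT (q \<in> \<alpha>) (q \<in> \<beta>))"
  have "op_mult (Pow Q \<times> Pow Q) ?W (kron V V) (x1, x2) (y1, y2) =
      c * op_mult (Pow K \<times> Pow K) (kron V V) ?U (x1, x2) (y1, y2)" for x1 x2 y1 y2
  proof (cases "x1 \<subseteq> Q \<and> x2 \<subseteq> Q \<and> y1 \<subseteq> K \<and> y2 \<subseteq> K")
    case True
    then show ?thesis
      using key \<beta> \<beta>'Q by (simp add: tensor2_pauli_CNOT_left tensor2_pauli_CNOT_right)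
  next
    case False
    then have "?W (x1, x2) p * kron V V p (y1, y2) = 0" for p
      using vanish by (cases p) (auto simp: kron_def tensor2_def)
    moreover have "kron V V (x1, x2) p * ?U p (y1, y2) = 0" for p
      using False vanish by (cases p) (auto simp: kron_def tensor2_def)
    ultimately have "op_mult (Pow Q \<times> Pow Q) ?W (kron V V) (x1, x2) (y1, y2) = 0"
      "op_mult (Pow K \<times> Pow K) (kron V V) ?U (x1, x2) (y1, y2) = 0"
      unfolding op_mult_def by (simp_all only: sum.neutral_const)
    then show ?thesis
      by simp
  qed
  then have "equal_on_encoded (Pow Q \<times> Pow Q) (Pow K \<times> Pow K) (kron V V) ?W ?U"
    unfolding equal_on_encoded_def using c by (intro exI[of _ c]) (auto simp: op_scale_def fun_eq_iff)
  then show ?thesis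
    by blast
qed

end

text \<open>Columns of \<open>V\<close> are images of basis states, so they lie in the code space
  and satisfy both check conditions; normalisation makes them nonzero. The other inclusion of the
  image equation says that every state passing the checks is encoded.\<close>

lemma compatible_basis_encoding:
  assumes "compatible_basis n k (css_stabilizer n G) X Z V"
  shows "compatible_encoding {1..n} {1..k} (check_supports n G) V"
proof -
  let ?Q = "{1..n}" and ?K = "{1..k}"
  have enc: "logical_encoding n k (css_stabilizer n G) X Z V"
    and H: "equal_on_encoded (Pow ?Q) (Pow ?K) V (tensor1 ?Q (\<lambda>_. gate_H)) (tensor1 ?K (\<lambda>_. gate_H))"
    and S: "\<forall>a \<in> ?K \<rightarrow> {- 1, 1}. \<exists>b \<in> ?Q \<rightarrow> {- 1, 1}.
          equal_on_encoded (Pow ?Q) (Pow ?K) V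
            (tensor1 ?Q (\<lambda>i. gate_S (b i))) (tensor1 ?K (\<lambda>j. gate_S (a j)))"
    using assms unfolding compatible_basis_def by blast+
  have vanish: "V x y = 0" if "\<not> (x \<subseteq> ?Q \<and> y \<subseteq> ?K)" for x y
    using enc that unfolding logical_encoding_def by blast
  have iso: "(\<Sum>x\<in>Pow ?Q. cnj (V x y) * V x y) = 1" if "y \<subseteq> ?K" for y
    using enc that unfolding logical_encoding_def by fastforce
  have image: "op_apply (Pow ?K) V ` states ?K = code_space ?Q (css_stabilizer n G)"
    using enc unfolding logical_encoding_def by blast
  have column: "(\<lambda>x. V x y) \<in> code_space ?Q (css_stabilizer n G)" if y: "y \<subseteq> ?K" for y
  proof -
    let ?e = "\<lambda>w. if w = y then 1 else 0 :: complex"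
    have "op_apply (Pow ?K) V ?e = (\<lambda>x. V x y)"
      using y by (simp add: op_apply_def fun_eq_iff if_distrib cong: if_cong)
    moreover have "?e \<in> states ?K"
      using y by (auto simp: states_def)
    ultimately show ?thesis
      using imageI[of ?e "states ?K" "op_apply (Pow ?K) V"] unfolding image by (simp only:)
  qed
  show ?thesis
  proof
    fix y
    assume "y \<subseteq> ?K"
    then show "\<exists>x. V x y \<noteq> 0"
      using iso[of y] by (auto intro: ccontr)
  next
    fix r
    assume "r \<in> check_supports n G"
    then show "r \<subseteq> ?Q"
      by (auto simp: check_supports_def vec_support_def)
  next
    fix r x y
    assume "r \<in> check_supports n G" "x \<subseteq> ?Q" "y \<subseteq> ?K"
    then show "V (x \<triangle> r) y = V x y" "psign ?Q r x * V x y = V x y"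
      using column[of y] by (simp_all only: code_space_css_iff)
  next
    fix \<psi>
    assume "\<psi> \<in> states ?Q"
      and "\<And>r x. r \<in> check_supports n G \<Longrightarrow> x \<subseteq> ?Q \<Longrightarrow>
        \<psi> (x \<triangle> r) = \<psi> x \<and> psign ?Q r x * \<psi> x = \<psi> x"
    then have "\<psi> \<in> code_space ?Q (css_stabilizer n G)"
      by (simp only: code_space_css_iff) simp
    then show "\<exists>\<xi>. \<psi> = op_apply (Pow ?K) V \<xi>"
      unfolding image[symmetric] by (auto simp only: image_iff)
  qed (use vanish H S in \<open>auto\<close>)
qed

section \<open>Unitarity of the gates used\<close>

lemma unitary_gate_I: "unitary_gate gate_I"
  by (simp add: unitary_gate_def gate_I_def UNIV_bool)

lemma unitary_gate_H: "unitary_gate gate_H"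
  by (simp add: unitary_gate_def gate_H_def UNIV_bool flip: of_real_mult)

lemma unitary_gate_S: "a \<in> {1, - 1} \<Longrightarrow> unitary_gate (gate_S a)"
  by (auto simp: unitary_gate_def gate_S_def UNIV_bool power_int_minus)

lemma sum_bool_pair:
  "(\<Sum>c\<in>UNIV. f c) = f (False, False) + f (False, True) + f (True, False) + f (True, True)"
  for f :: "bool \<times> bool \<Rightarrow> complex"
proof -
  have U: "(UNIV :: (bool \<times> bool) set) = {(False, False), (False, True), (True, False), (True, True)}"
    by auto
  show ?thesis
    unfolding U by (simp add: add.assoc)
qed

lemma unitary_identity2: "unitary_gate (\<lambda>s t :: bool \<times> bool. of_bool (s = t))"
  unfolding unitary_gate_def split_paired_All all_bool_eq sum_bool_pair by simp

lemma unitary_pauli_CNOT: "unitary_gate (pauli_CNOT a b)"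
  unfolding unitary_gate_def split_paired_All all_bool_eq sum_bool_pair pauli_CNOT_def fst_conv snd_conv
  by (cases a; cases b) simp_all


section \<open>Products over the blocks of a level\<close>

text \<open>Distributivity: \<open>\<phi>\<close> identifies a label in \<open>Y\<close> with a
  family of block labels, and a sum over all families of a product factors into a product of sums.
  This is the multiplication rule for tensor products of operators.\<close>

lemma op_mult_product:
  assumes "finite F" "finite Y0" "bij_betw \<phi> Y (PiE F (\<lambda>_. Y0))"
  shows "(\<Sum>y\<in>Y. (\<Prod>f\<in>F. M f (\<phi> y f)) * (\<Prod>f\<in>F. N f (\<phi> y f))) =
    (\<Prod>f\<in>F. \<Sum>w\<in>Y0. M f w * (N f w :: complex))"
proof -
  have "(\<Sum>y\<in>Y. (\<Prod>f\<in>F. M f (\<phi> y f)) * (\<Prod>f\<in>F. N f (\<phi> y f))) =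
      (\<Sum>y\<in>Y. \<Prod>f\<in>F. M f (\<phi> y f) * N f (\<phi> y f))"
    by (simp add: prod.distrib)
  also have "\<dots> = (\<Sum>g\<in>PiE F (\<lambda>_. Y0). \<Prod>f\<in>F. M f (g f) * N f (g f))"
    by (rule sum.reindex_bij_betw[OF assms(3)])
  also have "\<dots> = (\<Prod>f\<in>F. \<Sum>w\<in>Y0. M f w * N f w)"
    using assms by (simp add: prod_sum_PiE)
  finally show ?thesis .
qed

text \<open>The physical and logical gates may vary from block to block while the encoding
  \<open>E0\<close> is the same everywhere; the block phases multiply. The decompositions
  \<open>\<phi>\<close> and \<open>\<psi>\<close> are abstract so that one and two copies of a
  register are both instances.\<close>

lemma equal_on_encoded_product:
  assumes F: "finite F" and fin: "finite A0" "finite B0"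
    and bij: "bij_betw \<phi> A (PiE F (\<lambda>_. A0))" "bij_betw \<psi> B (PiE F (\<lambda>_. B0))"
    and E: "\<And>x y. E x y = (if x \<in> A \<and> y \<in> B then \<Prod>f\<in>F. E0 (\<phi> x f) (\<psi> y f) else 0)"
    and W: "\<And>x y. W x y = (if x \<in> A \<and> y \<in> A then \<Prod>f\<in>F. W0 f (\<phi> x f) (\<phi> y f) else 0)"
    and U: "\<And>x y. U x y = (if x \<in> B \<and> y \<in> B then \<Prod>f\<in>F. U0 f (\<psi> x f) (\<psi> y f) else 0)"
    and blocks: "\<And>f. f \<in> F \<Longrightarrow> equal_on_encoded A0 B0 E0 (W0 f) (U0 f)"
  shows "equal_on_encoded A B E W U"
proof -
  obtain c where c: "\<And>f. f \<in> F \<Longrightarrow> cmod (c f) = 1"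
    and eq: "\<And>f. f \<in> F \<Longrightarrow> op_mult A0 (W0 f) E0 = op_scale (c f) (op_mult B0 E0 (U0 f))"
    using blocks unfolding equal_on_encoded_def by metis
  have "op_mult A W E x y = prod c F * op_mult B E U x y" for x y
  proof (cases "x \<in> A \<and> y \<in> B")
    case True
    have "op_mult A W E x y =
        (\<Sum>v\<in>A. (\<Prod>f\<in>F. W0 f (\<phi> x f) (\<phi> v f)) * (\<Prod>f\<in>F. E0 (\<phi> v f) (\<psi> y f)))"
      unfolding op_mult_def using True by (intro sum.cong refl) (simp add: W E)
    also have "\<dots> = (\<Prod>f\<in>F. op_mult A0 (W0 f) E0 (\<phi> x f) (\<psi> y f))"
      unfolding op_mult_def
      by (rule op_mult_product[OF F fin(1) bij(1), where M = "\<lambda>f. W0 f (\<phi> x f)"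
            and N = "\<lambda>f w. E0 w (\<psi> y f)"])
    also have "\<dots> = (\<Prod>f\<in>F. c f * op_mult B0 E0 (U0 f) (\<phi> x f) (\<psi> y f))"
      by (intro prod.cong refl) (simp add: eq op_scale_def)
    also have "\<dots> = prod c F * (\<Prod>f\<in>F. op_mult B0 E0 (U0 f) (\<phi> x f) (\<psi> y f))"
      by (simp add: prod.distrib)
    also have "(\<Prod>f\<in>F. op_mult B0 E0 (U0 f) (\<phi> x f) (\<psi> y f)) =
        (\<Sum>v\<in>B. (\<Prod>f\<in>F. E0 (\<phi> x f) (\<psi> v f)) * (\<Prod>f\<in>F. U0 f (\<psi> v f) (\<psi> y f)))"
      unfolding op_mult_def
      by (rule op_mult_product[OF F fin(2) bij(2), where M = "\<lambda>f. E0 (\<phi> x f)"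
            and N = "\<lambda>f w. U0 f w (\<psi> y f)", symmetric])
    also have "\<dots> = op_mult B E U x y"
      unfolding op_mult_def using True by (intro sum.cong refl) (simp add: U E)
    finally show ?thesis .
  next
    case False
    have "W x v * E v y = 0" for v
      using False by (auto simp: W E)
    moreover have "E x v * U v y = 0" for v
      using False by (auto simp: E U)
    ultimately show ?thesis
      by (simp add: op_mult_def)
  qed
  moreover have "cmod (prod c F) = 1"
    using c by (simp add: prod_norm[symmetric])
  ultimately show ?thesis
    unfolding equal_on_encoded_def op_scale_def by blast
qed

text \<open>\<open>f\<close> labels a block and leaves coordinate \<open>p\<close> open. The result
  is the basis label that \<open>x\<close> induces on that block, with its qubits numbered by
  \<open>A\<close>.\<close>

definition fiber :: "nat \<Rightarrow> nat set \<Rightarrow> (nat \<Rightarrow> nat) set \<Rightarrow> (nat \<Rightarrow> nat) \<Rightarrow> nat set" where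
  "fiber p A x f = {i \<in> A. f(p := i) \<in> x}"

lemma fiber_subset: "fiber p A x f \<subseteq> A"
  by (auto simp: fiber_def)

text \<open>The coordinate \<open>p\<close> ranges over \<open>A\<close>, the remaining ones over the block labels \<open>F\<close>.\<close>

locale blocks =
  fixes p :: nat and F :: "(nat \<Rightarrow> nat) set" and A :: "nat set" and Q :: "(nat \<Rightarrow> nat) set"
  assumes finite_F: "finite F" and finite_A: "finite A"
    and bij: "bij_betw (\<lambda>(f, i). f(p := i)) (F \<times> A) Q"
begin

lemma Q_eq: "Q = {f(p := i) | f i. f \<in> F \<and> i \<in> A}"
  using bij by (auto simp: bij_betw_def image_def)

lemma update_in_Q: "f \<in> F \<Longrightarrow> i \<in> A \<Longrightarrow> f(p := i) \<in> Q"
  using Q_eq by blast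

lemma update_inject:
  "f \<in> F \<Longrightarrow> f' \<in> F \<Longrightarrow> i \<in> A \<Longrightarrow> i' \<in> A \<Longrightarrow> f(p := i) = f'(p := i') \<Longrightarrow> f = f' \<and> i = i'"
  using bij by (auto simp: bij_betw_def inj_on_def)

lemma prod_Q: "(\<Prod>q\<in>Q. g q) = (\<Prod>f\<in>F. \<Prod>i\<in>A. g (f(p := i)))"
proof -
  have "(\<Prod>q\<in>Q. g q) = (\<Prod>(f, i)\<in>F \<times> A. g (f(p := i)))"
    using prod.reindex_bij_betw[OF bij, of g] by (simp add: case_prod_unfold)
  then show ?thesis
    by (simp add: prod.cartesian_product)
qed

definition unfiber :: "((nat \<Rightarrow> nat) \<Rightarrow> nat set) \<Rightarrow> (nat \<Rightarrow> nat) set" where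
  "unfiber g = {f(p := i) | f i. f \<in> F \<and> i \<in> g f}"

lemma fiber_unfiber:
  assumes "\<And>f. f \<in> F \<Longrightarrow> g f \<subseteq> A" "f \<in> F"
  shows "fiber p A (unfiber g) f = g f"
proof -
  have "i \<in> g f" if i: "i \<in> A" "f(p := i) \<in> unfiber g" for i
  proof -
    obtain f' i' where f': "f(p := i) = f'(p := i')" "f' \<in> F" "i' \<in> g f'"
      using i(2) by (auto simp: unfiber_def)
    then show ?thesis
      using update_inject[OF assms(2) f'(2) i(1) _ f'(1)] assms(1) by blast
  qed
  then show ?thesis
    using assms by (auto simp: fiber_def unfiber_def)
qed

lemma unfiber_fiber: "x \<subseteq> Q \<Longrightarrow> unfiber (fiber p A x) = x"
  unfolding unfiber_def fiber_def by (subst (asm) Q_eq) fastforce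

lemma unfiber_cong: "(\<And>f. f \<in> F \<Longrightarrow> g f = g' f) \<Longrightarrow> unfiber g = unfiber g'"
  unfolding unfiber_def by blast

lemma unfiber_subset:
  assumes "\<And>f. f \<in> F \<Longrightarrow> g f \<subseteq> A"
  shows "unfiber g \<subseteq> Q"
  using assms update_in_Q by (auto simp: unfiber_def)

lemma bij_fiber: "bij_betw (\<lambda>x. \<lambda>f\<in>F. fiber p A x f) (Pow Q) (PiE F (\<lambda>_. Pow A))"
proof (rule bij_betw_byWitness[where f' = unfiber])
  show "\<forall>x\<in>Pow Q. unfiber (\<lambda>f\<in>F. fiber p A x f) = x"
  proof
    fix x
    assume "x \<in> Pow Q"
    then show "unfiber (\<lambda>f\<in>F. fiber p A x f) = x"
      using unfiber_fiber[of x] unfiber_cong[of "\<lambda>f\<in>F. fiber p A x f" "fiber p A x"] by simp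
  qed
  show "\<forall>g\<in>PiE F (\<lambda>_. Pow A). (\<lambda>f\<in>F. fiber p A (unfiber g) f) = g"
  proof (intro ballI ext)
    fix g f
    assume g: "g \<in> PiE F (\<lambda>_. Pow A)"
    then have "\<And>f. f \<in> F \<Longrightarrow> g f \<subseteq> A"
      by (auto simp: PiE_iff)
    then show "(\<lambda>f\<in>F. fiber p A (unfiber g) f) f = g f"
      using fiber_unfiber[of g f] g by (auto simp: PiE_iff extensional_def)
  qed
  show "(\<lambda>x. \<lambda>f\<in>F. fiber p A x f) ` Pow Q \<subseteq> PiE F (\<lambda>_. Pow A)"
    by (auto simp: PiE_iff dest: fiber_subset[THEN subsetD])
  show "unfiber ` PiE F (\<lambda>_. Pow A) \<subseteq> Pow Q"
    using unfiber_subset by (auto simp: PiE_iff)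
qed

lemma bij_fiber2:
  "bij_betw (\<lambda>(x1, x2). \<lambda>f\<in>F. (fiber p A x1 f, fiber p A x2 f)) (Pow Q \<times> Pow Q)
     (PiE F (\<lambda>_. Pow A \<times> Pow A))"
proof (rule bij_betw_byWitness[where f' = "\<lambda>g. (unfiber (\<lambda>f. fst (g f)), unfiber (\<lambda>f. snd (g f)))"])
  let ?\<phi> = "\<lambda>(x1, x2). \<lambda>f\<in>F. (fiber p A x1 f, fiber p A x2 f)"
  show "\<forall>x\<in>Pow Q \<times> Pow Q. (unfiber (\<lambda>f. fst (?\<phi> x f)), unfiber (\<lambda>f. snd (?\<phi> x f))) = x"
  proof
    fix x
    assume "x \<in> Pow Q \<times> Pow Q"
    then obtain x1 x2 where x: "x = (x1, x2)" "x1 \<subseteq> Q" "x2 \<subseteq> Q"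
      by auto
    have "unfiber (\<lambda>f. fst (?\<phi> x f)) = unfiber (fiber p A x1)"
      "unfiber (\<lambda>f. snd (?\<phi> x f)) = unfiber (fiber p A x2)"
      by (intro unfiber_cong; simp add: x)+
    then show "(unfiber (\<lambda>f. fst (?\<phi> x f)), unfiber (\<lambda>f. snd (?\<phi> x f))) = x"
      using x by (simp add: unfiber_fiber)
  qed
  show "\<forall>g\<in>PiE F (\<lambda>_. Pow A \<times> Pow A). ?\<phi> (unfiber (\<lambda>f. fst (g f)), unfiber (\<lambda>f. snd (g f))) = g"
  proof (intro ballI ext)
    fix g f
    assume g: "g \<in> PiE F (\<lambda>_. Pow A \<times> Pow A)"
    then have "\<And>f. f \<in> F \<Longrightarrow> fst (g f) \<subseteq> A \<and> snd (g f) \<subseteq> A"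
      by (force simp: PiE_iff mem_Times_iff)
    then show "?\<phi> (unfiber (\<lambda>f. fst (g f)), unfiber (\<lambda>f. snd (g f))) f = g f"
      using fiber_unfiber[of "\<lambda>f. fst (g f)" f] fiber_unfiber[of "\<lambda>f. snd (g f)" f] g
      by (auto simp: PiE_iff extensional_def)
  qed
  show "?\<phi> ` (Pow Q \<times> Pow Q) \<subseteq> PiE F (\<lambda>_. Pow A \<times> Pow A)"
    using fiber_subset by (auto simp: PiE_iff)
  show "(\<lambda>g. (unfiber (\<lambda>f. fst (g f)), unfiber (\<lambda>f. snd (g f)))) ` PiE F (\<lambda>_. Pow A \<times> Pow A)
      \<subseteq> Pow Q \<times> Pow Q"
  proof
    fix w
    assume "w \<in> (\<lambda>g. (unfiber (\<lambda>f. fst (g f)), unfiber (\<lambda>f. snd (g f)))) ` PiE F (\<lambda>_. Pow A \<times> Pow A)"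
    then obtain g where g: "g \<in> PiE F (\<lambda>_. Pow A \<times> Pow A)"
      and w: "w = (unfiber (\<lambda>f. fst (g f)), unfiber (\<lambda>f. snd (g f)))"
      by blast
    have "fst (g f) \<subseteq> A" "snd (g f) \<subseteq> A" if "f \<in> F" for f
      using PiE_mem[OF g that] by (auto simp: mem_Times_iff)
    then show "w \<in> Pow Q \<times> Pow Q"
      unfolding w by (simp add: unfiber_subset)
  qed
qed

text \<open>The restricted abstractions stay unreduced on purpose: the right-hand side then has the
  shape \<open>\<phi> x f\<close> that \<open>equal_on_encoded_product\<close> expects.\<close>

lemma tensor1_blocks:
  "tensor1 Q G x y = (if x \<in> Pow Q \<and> y \<in> Pow Q
     then \<Prod>f\<in>F. tensor1 A (\<lambda>i. G (f(p := i))) ((\<lambda>f\<in>F. fiber p A x f) f) ((\<lambda>f\<in>F. fiber p A y f) f)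
     else 0)"
proof -
  have "(\<Prod>f\<in>F. tensor1 A (\<lambda>i. G (f(p := i))) ((\<lambda>f\<in>F. fiber p A x f) f) ((\<lambda>f\<in>F. fiber p A y f) f)) =
      (\<Prod>f\<in>F. \<Prod>i\<in>A. G (f(p := i)) (f(p := i) \<in> x) (f(p := i) \<in> y))"
    by (intro prod.cong refl) (auto simp: tensor1_def fiber_def intro!: prod.cong)
  then show ?thesis
    by (simp add: tensor1_def prod_Q)
qed

lemma tensor2_blocks:
  "tensor2 Q G x y = (if x \<in> Pow Q \<times> Pow Q \<and> y \<in> Pow Q \<times> Pow Q
     then \<Prod>f\<in>F. tensor2 A (\<lambda>i. G (f(p := i)))
        ((\<lambda>(x1, x2). \<lambda>f\<in>F. (fiber p A x1 f, fiber p A x2 f)) x f)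
        ((\<lambda>(x1, x2). \<lambda>f\<in>F. (fiber p A x1 f, fiber p A x2 f)) y f)
     else 0)"
proof -
  obtain x1 x2 y1 y2 where [simp]: "x = (x1, x2)" "y = (y1, y2)"
    by (cases x, cases y)
  have "(\<Prod>f\<in>F. tensor2 A (\<lambda>i. G (f(p := i))) (fiber p A x1 f, fiber p A x2 f) (fiber p A y1 f, fiber p A y2 f)) =
      (\<Prod>f\<in>F. \<Prod>i\<in>A. G (f(p := i)) (f(p := i) \<in> x1, f(p := i) \<in> x2) (f(p := i) \<in> y1, f(p := i) \<in> y2))"
    by (intro prod.cong refl) (auto simp: tensor2_def fiber_def intro!: prod.cong)
  then show ?thesis
    by (simp add: tensor2_def prod_Q cong: prod.cong)
qed

end


section \<open>Descending through the levels\<close>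

lemma level_qubits_eq:
  "level_qubits L n k l = PiE {1..L} (\<lambda>p. if p \<le> l then {1..k p} else {1..n p})"
  by (simp only: level_qubits_def index_box_def)

lemma finite_level_qubits [simp]: "finite (level_qubits L n k l)"
  unfolding level_qubits_eq by (rule finite_PiE) auto

lemma bij_betw_PiE_update:
  assumes "p \<in> I"
  shows "bij_betw (\<lambda>(f, i). f(p := i)) (PiE (I - {p}) T \<times> T p) (PiE I T)"
proof -
  have "PiE I T = (\<lambda>(i, f). f(p := i)) ` (T p \<times> PiE (I - {p}) T)"
    using PiE_insert_eq[of p "I - {p}" T] assms by (simp add: insert_absorb)
  also have "\<dots> = (\<lambda>(f, i). f(p := i)) ` (PiE (I - {p}) T \<times> T p)"
    by (auto simp: image_iff)
  finally have "(\<lambda>(f, i). f(p := i)) ` (PiE (I - {p}) T \<times> T p) = PiE I T" ..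
  moreover have "inj_on (\<lambda>(f, i). f(p := i)) (PiE (I - {p}) T \<times> T p)"
  proof (rule inj_onI, clarify)
    fix f i f' i'
    assume f: "f \<in> PiE (I - {p}) T" "f' \<in> PiE (I - {p}) T" and eq: "f(p := i) = f'(p := i')"
    have "f q = f' q" for q
    proof (cases "q = p")
      case True
      then show ?thesis
        using f by (simp add: PiE_def extensional_def)
    next
      case False
      then show ?thesis
        using fun_cong[OF eq, of q] by simp
    qed
    then show "f = f' \<and> i = i'"
      using fun_cong[OF eq, of p] by auto
  qed
  ultimately show ?thesis
    by (simp add: bij_betw_def)
qed

lemma finite_level_blocks: "finite (level_blocks L n k l)"
  unfolding level_blocks_def by (rule finite_PiE) auto

text \<open>Away from coordinate \<open>Suc l\<close>, the conditions \<open>p < Suc l\<close>,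
  \<open>p \<le> l\<close> and \<open>p \<le> Suc l\<close> agree. One set of block labels thus
  serves two adjacent levels, and only the range filled in at \<open>Suc l\<close> changes from
  \<open>n\<close> to \<open>k\<close>.\<close>

lemma level_blocks_lower:
  assumes "Suc l \<le> L"
  shows "blocks (Suc l) (level_blocks L n k (Suc l)) {1..n (Suc l)} (level_qubits L n k l)"
proof
  let ?T = "\<lambda>p. if p \<le> l then {1..k p} else {1..n p}"
  have "level_blocks L n k (Suc l) = PiE ({1..L} - {Suc l}) ?T"
    unfolding level_blocks_def by (rule PiE_cong) auto
  then show "bij_betw (\<lambda>(f, i). f(Suc l := i)) (level_blocks L n k (Suc l) \<times> {1..n (Suc l)})
      (level_qubits L n k l)"
    using bij_betw_PiE_update[of "Suc l" "{1..L}" ?T] assms by (simp add: level_qubits_eq)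
qed (simp_all add: finite_level_blocks)

lemma level_blocks_upper:
  assumes "Suc l \<le> L"
  shows "blocks (Suc l) (level_blocks L n k (Suc l)) {1..k (Suc l)} (level_qubits L n k (Suc l))"
proof
  let ?T = "\<lambda>p. if p \<le> Suc l then {1..k p} else {1..n p}"
  have "level_blocks L n k (Suc l) = PiE ({1..L} - {Suc l}) ?T"
    unfolding level_blocks_def by (rule PiE_cong) auto
  then show "bij_betw (\<lambda>(f, i). f(Suc l := i)) (level_blocks L n k (Suc l) \<times> {1..k (Suc l)})
      (level_qubits L n k (Suc l))"
    using bij_betw_PiE_update[of "Suc l" "{1..L}" ?T] assms by (simp add: level_qubits_eq)
qed (simp_all add: finite_level_blocks)

text \<open>Recovers the block label from any of its qubits, which allows gates chosen block by
  block to be glued into one function on qubits.\<close>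

lemma restrict_level_block:
  assumes "f \<in> level_blocks L n k l"
  shows "restrict (f(l := i)) ({1..L} - {l}) = f"
  using assms by (auto simp: level_blocks_def PiE_iff extensional_def fun_eq_iff)

text \<open>The invariant of the descent: qubits marked by \<open>P\<close> carry gates from the
  class \<open>\<G>\<close>, all others the neutral gate \<open>e\<close>.\<close>

definition gate_family :: "((nat \<Rightarrow> nat) \<Rightarrow> bool) \<Rightarrow> 'g set \<Rightarrow> 'g \<Rightarrow> (nat \<Rightarrow> nat) set \<Rightarrow> ((nat \<Rightarrow> nat) \<Rightarrow> 'g) set" where
  "gate_family P \<G> e Q = {G. \<forall>q\<in>Q. if P q then G q \<in> \<G> else G q = e}"

text \<open>As \<open>P\<close> ignores coordinate \<open>Suc l\<close>, a block is marked as a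
  whole or not at all. Marked blocks use \<open>step\<close>, the others \<open>unit\<close>. The
  relation \<open>R\<close> is abstract to cover both one and two copies.\<close>

lemma choose_block_gates:
  assumes l: "Suc l \<le> L"
    and G: "G \<in> gate_family P \<G> e (level_qubits L n k (Suc l))"
    and P: "\<And>q v. P (q(Suc l := v)) = P q"
    and step: "\<And>g. g \<in> {1..k (Suc l)} \<rightarrow> \<G> \<Longrightarrow> \<exists>g'\<in>{1..n (Suc l)} \<rightarrow> \<G>. R g' g"
    and unit: "\<And>g. (\<And>i. i \<in> {1..k (Suc l)} \<Longrightarrow> g i = e) \<Longrightarrow> R (\<lambda>_. e) g"
  shows "\<exists>G'\<in>gate_family P \<G> e (level_qubits L n k l).
    \<forall>f\<in>level_blocks L n k (Suc l). R (\<lambda>i. G' (f(Suc l := i))) (\<lambda>i. G (f(Suc l := i)))"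
proof -
  interpret lower: blocks "Suc l" "level_blocks L n k (Suc l)" "{1..n (Suc l)}" "level_qubits L n k l"
    using l by (rule level_blocks_lower)
  interpret upper: blocks "Suc l" "level_blocks L n k (Suc l)" "{1..k (Suc l)}" "level_qubits L n k (Suc l)"
    using l by (rule level_blocks_upper)
  have "\<exists>g'. (\<forall>i\<in>{1..n (Suc l)}. if P f then g' i \<in> \<G> else g' i = e) \<and> R g' (\<lambda>i. G (f(Suc l := i)))"
    if f: "f \<in> level_blocks L n k (Suc l)" for f
  proof (cases "P f")
    case True
    then have "(\<lambda>i. G (f(Suc l := i))) \<in> {1..k (Suc l)} \<rightarrow> \<G>"
      using G upper.update_in_Q[OF f] P by (fastforce simp: gate_family_def)
    then show ?thesis
      using step[of "\<lambda>i. G (f(Suc l := i))"] True by (auto simp: Pi_iff)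
  next
    case False
    then have "G (f(Suc l := i)) = e" if "i \<in> {1..k (Suc l)}" for i
      using G upper.update_in_Q[OF f that] P by (fastforce simp: gate_family_def)
    then show ?thesis
      using unit False by (intro exI[of _ "\<lambda>_. e"]) simp
  qed
  then obtain g' where g': "\<And>f i. f \<in> level_blocks L n k (Suc l) \<Longrightarrow> i \<in> {1..n (Suc l)} \<Longrightarrow>
        if P f then g' f i \<in> \<G> else g' f i = e"
      "\<And>f. f \<in> level_blocks L n k (Suc l) \<Longrightarrow> R (g' f) (\<lambda>i. G (f(Suc l := i)))"
    by metis
  \<comment> \<open>Block label and position are both read off the qubit, so the choices for
    different blocks cannot clash.\<close>
  define G' where "G' q = g' (restrict q ({1..L} - {Suc l})) (q (Suc l))" for q
  have G': "G' (f(Suc l := i)) = g' f i" if "f \<in> level_blocks L n k (Suc l)" for f i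
    using restrict_level_block[OF that, of i] by (simp add: G'_def)
  have "G' \<in> gate_family P \<G> e (level_qubits L n k l)"
    unfolding gate_family_def lower.Q_eq using g'(1) P by (fastforce simp: G')
  moreover have "R (\<lambda>i. G' (f(Suc l := i))) (\<lambda>i. G (f(Suc l := i)))"
    if "f \<in> level_blocks L n k (Suc l)" for f
    using g'(2)[OF that] by (simp add: G'[OF that])
  ultimately show ?thesis
    by blast
qed

text \<open>The encoding grows by a factor on the right at the top level. A gate at level
  \<open>Suc u\<close> is therefore first replaced by one at level \<open>u\<close>, and the
  induction hypothesis, general in the gate, takes that one down to \<open>t\<close>.\<close>

lemma descend:
  assumes le: "t \<le> l"
    and base: "\<And>U. U \<in> \<C> t \<Longrightarrow> equal_on_encoded (A t) (A t) (E t) U U"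
    and E: "\<And>u. t \<le> u \<Longrightarrow> u < l \<Longrightarrow> E (Suc u) = op_mult (A u) (E u) (E1 (Suc u))"
    and step: "\<And>u U. t \<le> u \<Longrightarrow> u < l \<Longrightarrow> U \<in> \<C> (Suc u) \<Longrightarrow>
      \<exists>U'\<in>\<C> u. equal_on_encoded (A u) (A (Suc u)) (E1 (Suc u)) U' U"
    and U: "U \<in> \<C> l"
  shows "\<exists>W\<in>\<C> t. equal_on_encoded (A t) (A l) (E l) W U"
proof -
  have "\<exists>W\<in>\<C> t. equal_on_encoded (A t) (A u) (E u) W U" if "t \<le> u" "u \<le> l" "U \<in> \<C> u" for u U
    using that
  proof (induction u arbitrary: U rule: dec_induct)
    case base
    then show ?case
      using assms(2) by blast
  next
    case (step u)
    then obtain U' where "U' \<in> \<C> u" "equal_on_encoded (A u) (A (Suc u)) (E1 (Suc u)) U' U"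
      using assms(4)[of u U] by auto
    moreover from this obtain W where "W \<in> \<C> t" "equal_on_encoded (A t) (A u) (E u) W U'"
      using step.IH[of U'] step.prems by auto
    ultimately show ?case
      using step E[of u] equal_on_encoded_comp by (metis Suc_le_lessD)
  qed
  then show ?thesis
    using le U by blast
qed

section \<open>Identity operators, and the descent step for one and two copies\<close>

lemma tensor1_cong: "(\<And>q. q \<in> Q \<Longrightarrow> G q = G' q) \<Longrightarrow> tensor1 Q G = tensor1 Q G'"
  by (auto simp: tensor1_def fun_eq_iff intro!: prod.cong)

lemma tensor2_cong: "(\<And>q. q \<in> Q \<Longrightarrow> F q = F' q) \<Longrightarrow> tensor2 Q F = tensor2 Q F'"
  by (auto simp: tensor2_def fun_eq_iff intro!: prod.cong)

lemma equal_on_encoded_refl: "op_mult A W E = op_mult B E U \<Longrightarrow> equal_on_encoded A B E W U"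
  unfolding equal_on_encoded_def by (intro exI[of _ 1]) (simp add: op_scale_def)

lemma op_mult_I2_left:
  fixes M :: "('q set \<times> 'q set, 'b) op"
  assumes "finite Q" "\<And>x1 x2 y. \<not> (x1 \<subseteq> Q \<and> x2 \<subseteq> Q) \<Longrightarrow> M (x1, x2) y = 0"
  shows "op_mult (Pow Q \<times> Pow Q) (tensor2 Q (\<lambda>_ s t. of_bool (s = t))) M = M"
proof (rule ext, rule ext)
  fix x :: "'q set \<times> 'q set" and y
  obtain x1 x2 where x: "x = (x1, x2)"
    by (cases x)
  have "op_mult (Pow Q \<times> Pow Q) (tensor2 Q (\<lambda>_ s t. of_bool (s = t))) M x y =
      (\<Sum>p\<in>Pow Q \<times> Pow Q. if p = x then M x y else 0)"
    unfolding op_mult_def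
  proof (intro sum.cong refl)
    fix p
    assume "p \<in> Pow Q \<times> Pow Q"
    then show "tensor2 Q (\<lambda>_ s t. of_bool (s = t)) x p * M p y = (if p = x then M x y else 0)"
      using assms(1) unfolding x by (cases p) (auto simp: tensor2_I)
  qed
  also have "\<dots> = M x y"
    using assms(1) assms(2)[of x1 x2 y] unfolding x by (cases "x1 \<subseteq> Q \<and> x2 \<subseteq> Q") auto
  finally show "op_mult (Pow Q \<times> Pow Q) (tensor2 Q (\<lambda>_ s t. of_bool (s = t))) M x y = M x y" .
qed

lemma op_mult_I2_right:
  fixes M :: "('a, 'q set \<times> 'q set) op"
  assumes "finite Q" "\<And>x y1 y2. \<not> (y1 \<subseteq> Q \<and> y2 \<subseteq> Q) \<Longrightarrow> M x (y1, y2) = 0"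
  shows "op_mult (Pow Q \<times> Pow Q) M (tensor2 Q (\<lambda>_ s t. of_bool (s = t))) = M"
proof (rule ext, rule ext)
  fix x and y :: "'q set \<times> 'q set"
  obtain y1 y2 where y: "y = (y1, y2)"
    by (cases y)
  have "op_mult (Pow Q \<times> Pow Q) M (tensor2 Q (\<lambda>_ s t. of_bool (s = t))) x y =
      (\<Sum>p\<in>Pow Q \<times> Pow Q. if p = y then M x y else 0)"
    unfolding op_mult_def
  proof (intro sum.cong refl)
    fix p
    assume "p \<in> Pow Q \<times> Pow Q"
    then show "M x p * tensor2 Q (\<lambda>_ s t. of_bool (s = t)) p y = (if p = y then M x y else 0)"
      using assms(1) unfolding y by (cases p) (auto simp: tensor2_I)
  qed
  also have "\<dots> = M x y"
    using assms(1) assms(2)[of y1 y2 x] unfolding y by (cases "y1 \<subseteq> Q \<and> y2 \<subseteq> Q") auto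
  finally show "op_mult (Pow Q \<times> Pow Q) M (tensor2 Q (\<lambda>_ s t. of_bool (s = t))) x y = M x y" .
qed

lemma kron_pair: "kron M N (x1, x2) (y1, y2) = M x1 y1 * N x2 y2"
  by (simp add: kron_def)

lemma kron_op_mult:
  fixes M :: "('a, 'b) op" and N :: "('b, 'c) op" and M' :: "('d, 'e) op" and N' :: "('e, 'f) op"
  shows "kron (op_mult B M N) (op_mult C M' N') = op_mult (B \<times> C) (kron M M') (kron N N')"
proof (rule ext, rule ext)
  fix x :: "'a \<times> 'd" and z :: "'c \<times> 'f"
  obtain x1 x2 z1 z2 where xz: "x = (x1, x2)" "z = (z1, z2)"
    by (cases x, cases z)
  show "kron (op_mult B M N) (op_mult C M' N') x z = op_mult (B \<times> C) (kron M M') (kron N N') x z"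
    unfolding xz kron_def op_mult_def
    by (simp add: sum_product sum.cartesian_product mult_ac case_prod_unfold)
qed

definition one_block_ops where
  "one_block_ops L n k P \<G> l =
     tensor1 (level_qubits L n k l) ` gate_family P \<G> gate_I (level_qubits L n k l)"

definition two_block_ops where
  "two_block_ops L n k P \<G> l = tensor2 (level_qubits L n k l) `
     gate_family P \<G> (\<lambda>s t. of_bool (s = t)) (level_qubits L n k l)"

lemma one_block_step:
  assumes l: "Suc l \<le> L" and P: "\<And>q v. P (q(Suc l := v)) = P q"
    and vanish: "\<And>x y. \<not> (x \<subseteq> {1..n (Suc l)} \<and> y \<subseteq> {1..k (Suc l)}) \<Longrightarrow> V (Suc l) x y = 0"
    and step: "\<And>g. g \<in> {1..k (Suc l)} \<rightarrow> \<G> \<Longrightarrow> \<exists>g'\<in>{1..n (Suc l)} \<rightarrow> \<G>.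
      equal_on_encoded (Pow {1..n (Suc l)}) (Pow {1..k (Suc l)}) (V (Suc l))
        (tensor1 {1..n (Suc l)} g') (tensor1 {1..k (Suc l)} g)"
    and U: "U \<in> one_block_ops L n k P \<G> (Suc l)"
  shows "\<exists>U'\<in>one_block_ops L n k P \<G> l.
    equal_on_encoded (Pow (level_qubits L n k l)) (Pow (level_qubits L n k (Suc l)))
      (block_encoding L n k V (Suc l)) U' U"
proof -
  let ?Q = "{1..n (Suc l)}" and ?K = "{1..k (Suc l)}" and ?F = "level_blocks L n k (Suc l)"
  let ?R = "\<lambda>g' g. equal_on_encoded (Pow ?Q) (Pow ?K) (V (Suc l)) (tensor1 ?Q g') (tensor1 ?K g)"
  interpret lower: blocks "Suc l" ?F ?Q "level_qubits L n k l"
    using l by (rule level_blocks_lower)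
  interpret upper: blocks "Suc l" ?F ?K "level_qubits L n k (Suc l)"
    using l by (rule level_blocks_upper)
  obtain G where G: "G \<in> gate_family P \<G> gate_I (level_qubits L n k (Suc l))"
    and U_eq: "U = tensor1 (level_qubits L n k (Suc l)) G"
    using U by (auto simp: one_block_ops_def)
  \<comment> \<open>A tensor product of identities is the projection onto labels inside the
    register. It passes through \<open>V\<close> because \<open>V\<close> has no entries outside its
    index sets.\<close>
  have unit: "?R (\<lambda>_. gate_I) g" if "\<And>i. i \<in> ?K \<Longrightarrow> g i = gate_I" for g
  proof -
    have "tensor1 ?K g = tensor1 ?K (\<lambda>_. gate_I)"
      using that by (rule tensor1_cong)
    then show ?thesis
      using op_mult_I_left[of ?Q "V (Suc l)"] op_mult_I_right[of ?K "V (Suc l)"] vanish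
      by (intro equal_on_encoded_refl) simp
  qed
  obtain G' where G': "G' \<in> gate_family P \<G> gate_I (level_qubits L n k l)"
    and R: "\<And>f. f \<in> ?F \<Longrightarrow> ?R (\<lambda>i. G' (f(Suc l := i))) (\<lambda>i. G (f(Suc l := i)))"
    using choose_block_gates[where R = ?R, OF l G P step unit] by blast
  have "equal_on_encoded (Pow (level_qubits L n k l)) (Pow (level_qubits L n k (Suc l)))
      (block_encoding L n k V (Suc l)) (tensor1 (level_qubits L n k l) G') U"
    unfolding U_eq
  proof (rule equal_on_encoded_product[OF lower.finite_F _ _ lower.bij_fiber upper.bij_fiber _
        lower.tensor1_blocks upper.tensor1_blocks R])
    fix x y
    show "block_encoding L n k V (Suc l) x y =
        (if x \<in> Pow (level_qubits L n k l) \<and> y \<in> Pow (level_qubits L n k (Suc l))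
         then \<Prod>f\<in>?F. V (Suc l) ((\<lambda>f\<in>?F. fiber (Suc l) ?Q x f) f) ((\<lambda>f\<in>?F. fiber (Suc l) ?K y f) f)
         else 0)"
      by (simp add: block_encoding_def fiber_def cong: prod.cong)
  qed simp_all
  then show ?thesis
    using G' by (auto simp: one_block_ops_def)
qed

text \<open>Both copies use the same block labels, so the Kronecker square of the block encoding is
  again a product over blocks, decomposed by pairs of fibers.\<close>

lemma two_block_step:
  assumes l: "Suc l \<le> L" and P: "\<And>q v. P (q(Suc l := v)) = P q"
    and vanish: "\<And>x y. \<not> (x \<subseteq> {1..n (Suc l)} \<and> y \<subseteq> {1..k (Suc l)}) \<Longrightarrow> V (Suc l) x y = 0"
    and step: "\<And>g. g \<in> {1..k (Suc l)} \<rightarrow> \<G> \<Longrightarrow> \<exists>g'\<in>{1..n (Suc l)} \<rightarrow> \<G>.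
      equal_on_encoded (Pow {1..n (Suc l)} \<times> Pow {1..n (Suc l)}) (Pow {1..k (Suc l)} \<times> Pow {1..k (Suc l)})
        (kron (V (Suc l)) (V (Suc l))) (tensor2 {1..n (Suc l)} g') (tensor2 {1..k (Suc l)} g)"
    and U: "U \<in> two_block_ops L n k P \<G> (Suc l)"
  shows "\<exists>U'\<in>two_block_ops L n k P \<G> l.
    equal_on_encoded (Pow (level_qubits L n k l) \<times> Pow (level_qubits L n k l))
      (Pow (level_qubits L n k (Suc l)) \<times> Pow (level_qubits L n k (Suc l)))
      (kron (block_encoding L n k V (Suc l)) (block_encoding L n k V (Suc l))) U' U"
proof -
  let ?Q = "{1..n (Suc l)}" and ?K = "{1..k (Suc l)}" and ?F = "level_blocks L n k (Suc l)"
  let ?VV = "kron (V (Suc l)) (V (Suc l))"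
  let ?R = "\<lambda>g' g. equal_on_encoded (Pow ?Q \<times> Pow ?Q) (Pow ?K \<times> Pow ?K) ?VV (tensor2 ?Q g') (tensor2 ?K g)"
  let ?I = "\<lambda>s t. of_bool (s = t) :: complex"
  interpret lower: blocks "Suc l" ?F ?Q "level_qubits L n k l"
    using l by (rule level_blocks_lower)
  interpret upper: blocks "Suc l" ?F ?K "level_qubits L n k (Suc l)"
    using l by (rule level_blocks_upper)
  obtain G where G: "G \<in> gate_family P \<G> ?I (level_qubits L n k (Suc l))"
    and U_eq: "U = tensor2 (level_qubits L n k (Suc l)) G"
    using U by (auto simp: two_block_ops_def)
  have unit: "?R (\<lambda>_. ?I) g" if "\<And>i. i \<in> ?K \<Longrightarrow> g i = ?I" for g
  proof -
    have g: "tensor2 ?K g = tensor2 ?K (\<lambda>_. ?I)"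
      using that by (rule tensor2_cong)
    have left: "?VV (x1, x2) y = 0" if "\<not> (x1 \<subseteq> ?Q \<and> x2 \<subseteq> ?Q)" for x1 x2 y
      using that vanish by (metis kron_pair mult_zero_left mult_zero_right surj_pair)
    have right: "?VV x (y1, y2) = 0" if "\<not> (y1 \<subseteq> ?K \<and> y2 \<subseteq> ?K)" for x y1 y2
      using that vanish by (metis kron_pair mult_zero_left mult_zero_right surj_pair)
    have "op_mult (Pow ?Q \<times> Pow ?Q) (tensor2 ?Q (\<lambda>_. ?I)) ?VV = ?VV"
      by (rule op_mult_I2_left[where M = ?VV, OF finite_atLeastAtMost left])
    moreover have "op_mult (Pow ?K \<times> Pow ?K) ?VV (tensor2 ?K (\<lambda>_. ?I)) = ?VV"
      by (rule op_mult_I2_right[where M = ?VV, OF finite_atLeastAtMost right])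
    ultimately show ?thesis
      unfolding g by (intro equal_on_encoded_refl) (simp only:)
  qed
  obtain G' where G': "G' \<in> gate_family P \<G> ?I (level_qubits L n k l)"
    and R: "\<And>f. f \<in> ?F \<Longrightarrow> ?R (\<lambda>i. G' (f(Suc l := i))) (\<lambda>i. G (f(Suc l := i)))"
    using choose_block_gates[where R = ?R, OF l G P step unit] by blast
  have "equal_on_encoded (Pow (level_qubits L n k l) \<times> Pow (level_qubits L n k l))
      (Pow (level_qubits L n k (Suc l)) \<times> Pow (level_qubits L n k (Suc l)))
      (kron (block_encoding L n k V (Suc l)) (block_encoding L n k V (Suc l)))
      (tensor2 (level_qubits L n k l) G') U"
    unfolding U_eq
  proof (rule equal_on_encoded_product[OF lower.finite_F _ _ lower.bij_fiber2 upper.bij_fiber2 _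
        lower.tensor2_blocks upper.tensor2_blocks R])
    fix x y :: "(nat \<Rightarrow> nat) set \<times> (nat \<Rightarrow> nat) set"
    obtain x1 x2 y1 y2 where xy: "x = (x1, x2)" "y = (y1, y2)"
      by (cases x, cases y)
    show "kron (block_encoding L n k V (Suc l)) (block_encoding L n k V (Suc l)) x y =
        (if x \<in> Pow (level_qubits L n k l) \<times> Pow (level_qubits L n k l)
            \<and> y \<in> Pow (level_qubits L n k (Suc l)) \<times> Pow (level_qubits L n k (Suc l))
         then \<Prod>f\<in>?F. ?VV
           ((\<lambda>(x1, x2). \<lambda>f\<in>?F. (fiber (Suc l) ?Q x1 f, fiber (Suc l) ?Q x2 f)) x f)
           ((\<lambda>(x1, x2). \<lambda>f\<in>?F. (fiber (Suc l) ?K x1 f, fiber (Suc l) ?K x2 f)) y f)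
         else 0)"
      unfolding xy by (simp add: kron_def block_encoding_def fiber_def prod.distrib cong: prod.cong)
  qed simp_all
  then show ?thesis
    using G' by (auto simp: two_block_ops_def)
qed

lemma encoding_self: "encoding L n k V t t = tensor1 (level_qubits L n k t) (\<lambda>_. gate_I)"
  by (cases t) simp_all

lemma encoding_Suc:
  "t \<le> u \<Longrightarrow> encoding L n k V t (Suc u) =
    op_mult (Pow (level_qubits L n k u)) (encoding L n k V t u) (block_encoding L n k V (Suc u))"
  by simp

lemma tensor1_outside: "\<not> (x \<subseteq> Q \<and> y \<subseteq> Q) \<Longrightarrow> tensor1 Q G x y = 0"
  unfolding tensor1_def by (rule if_not_P)

lemma tensor2_outside:
  assumes "\<not> (x1 \<subseteq> Q \<and> x2 \<subseteq> Q) \<or> \<not> (y1 \<subseteq> Q \<and> y2 \<subseteq> Q)"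
  shows "tensor2 Q F (x1, x2) (y1, y2) = 0"
proof -
  have "\<not> (x1 \<subseteq> Q \<and> x2 \<subseteq> Q \<and> y1 \<subseteq> Q \<and> y2 \<subseteq> Q)"
    using assms by blast
  then show ?thesis
    unfolding tensor2_def prod.case by (rule if_not_P)
qed

text \<open>Closure of \<open>\<G>\<close> under each single code is enough to reach level
  \<open>t\<close>. Unitarity is read off only there, since each resulting gate is in
  \<open>\<G>\<close> or is the identity.\<close>

lemma descend_one:
  assumes t: "t \<le> l" "l \<le> L" and P: "\<And>p q v. p \<in> {t<..l} \<Longrightarrow> P (q(p := v)) = P q"
    and vanish: "\<And>p x y. p \<in> {1..L} \<Longrightarrow> \<not> (x \<subseteq> {1..n p} \<and> y \<subseteq> {1..k p}) \<Longrightarrow> V p x y = 0"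
    and step: "\<And>p g. p \<in> {1..L} \<Longrightarrow> g \<in> {1..k p} \<rightarrow> \<G> \<Longrightarrow> \<exists>g'\<in>{1..n p} \<rightarrow> \<G>.
      equal_on_encoded (Pow {1..n p}) (Pow {1..k p}) (V p) (tensor1 {1..n p} g') (tensor1 {1..k p} g)"
    and unitary: "\<And>g. g \<in> \<G> \<Longrightarrow> unitary_gate g"
    and U: "U \<in> one_block_ops L n k P \<G> l"
  shows "transversal_one L n k V l t U"
proof -
  have "\<exists>W\<in>one_block_ops L n k P \<G> t. equal_on_encoded (Pow (level_qubits L n k t))
      (Pow (level_qubits L n k l)) (encoding L n k V t l) W U"
  proof (rule descend[where A = "\<lambda>u. Pow (level_qubits L n k u)" and E = "encoding L n k V t"
        and ?E1.0 = "block_encoding L n k V" and \<C> = "one_block_ops L n k P \<G>"])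
    show "t \<le> l" "U \<in> one_block_ops L n k P \<G> l"
      by (rule t(1), rule U)
  next
    fix u
    assume "t \<le> u"
    then show "encoding L n k V t (Suc u) =
        op_mult (Pow (level_qubits L n k u)) (encoding L n k V t u) (block_encoding L n k V (Suc u))"
      by (rule encoding_Suc)
  next
    fix U
    assume "U \<in> one_block_ops L n k P \<G> t"
    then show "equal_on_encoded (Pow (level_qubits L n k t)) (Pow (level_qubits L n k t))
        (encoding L n k V t t) U U"
      unfolding encoding_self
      by (intro equal_on_encoded_refl)
         (auto simp: one_block_ops_def op_mult_I_left op_mult_I_right tensor1_outside)
  next
    fix u U
    assume u: "t \<le> u" "u < l" and "U \<in> one_block_ops L n k P \<G> (Suc u)"
    then show "\<exists>U'\<in>one_block_ops L n k P \<G> u.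
        equal_on_encoded (Pow (level_qubits L n k u)) (Pow (level_qubits L n k (Suc u)))
          (block_encoding L n k V (Suc u)) U' U"
      using t by (intro one_block_step P vanish step) auto
  qed
  then obtain G where G: "G \<in> gate_family P \<G> gate_I (level_qubits L n k t)"
    and eq: "equal_on_encoded (Pow (level_qubits L n k t)) (Pow (level_qubits L n k l))
      (encoding L n k V t l) (tensor1 (level_qubits L n k t) G) U"
    unfolding one_block_ops_def by blast
  have "unitary_gate (G q)" if "q \<in> level_qubits L n k t" for q
    using G that unitary[of "G q"] unitary_gate_I by (cases "P q") (auto simp: gate_family_def)
  then show ?thesis
    unfolding transversal_one_def using eq by blast
qed

lemma descend_two:
  assumes t: "t \<le> l" "l \<le> L" and P: "\<And>p q v. p \<in> {t<..l} \<Longrightarrow> P (q(p := v)) = P q"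
    and vanish: "\<And>p x y. p \<in> {1..L} \<Longrightarrow> \<not> (x \<subseteq> {1..n p} \<and> y \<subseteq> {1..k p}) \<Longrightarrow> V p x y = 0"
    and step: "\<And>p g. p \<in> {1..L} \<Longrightarrow> g \<in> {1..k p} \<rightarrow> \<G> \<Longrightarrow> \<exists>g'\<in>{1..n p} \<rightarrow> \<G>.
      equal_on_encoded (Pow {1..n p} \<times> Pow {1..n p}) (Pow {1..k p} \<times> Pow {1..k p}) (kron (V p) (V p))
        (tensor2 {1..n p} g') (tensor2 {1..k p} g)"
    and unitary: "\<And>g. g \<in> \<G> \<Longrightarrow> unitary_gate g"
    and U: "U \<in> two_block_ops L n k P \<G> l"
  shows "transversal_two L n k V l t U"
proof -
  let ?E = "\<lambda>u. kron (encoding L n k V t u) (encoding L n k V t u)"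
  let ?A = "\<lambda>u. Pow (level_qubits L n k u) \<times> Pow (level_qubits L n k u)"
  have "\<exists>W\<in>two_block_ops L n k P \<G> t. equal_on_encoded (?A t) (?A l) (?E l) W U"
  proof (rule descend[where A = ?A and E = ?E and \<C> = "two_block_ops L n k P \<G>"
        and ?E1.0 = "\<lambda>u. kron (block_encoding L n k V u) (block_encoding L n k V u)"])
    show "t \<le> l" "U \<in> two_block_ops L n k P \<G> l"
      by (rule t(1), rule U)
  next
    fix U
    assume U: "U \<in> two_block_ops L n k P \<G> t"
    then have out: "U (x1, x2) (y1, y2) = 0"
      if "\<not> (x1 \<subseteq> level_qubits L n k t \<and> x2 \<subseteq> level_qubits L n k t) \<or>
        \<not> (y1 \<subseteq> level_qubits L n k t \<and> y2 \<subseteq> level_qubits L n k t)" for x1 x2 y1 y2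
      using that by (auto simp only: two_block_ops_def intro: tensor2_outside)
    have left: "U (x1, x2) y = 0" if "\<not> (x1 \<subseteq> level_qubits L n k t \<and> x2 \<subseteq> level_qubits L n k t)" for x1 x2 y
      using that out[of x1 x2 "fst y" "snd y"] by simp
    have right: "U x (y1, y2) = 0" if "\<not> (y1 \<subseteq> level_qubits L n k t \<and> y2 \<subseteq> level_qubits L n k t)" for x y1 y2
      using that out[of "fst x" "snd x" y1 y2] by simp
    have E: "?E t = tensor2 (level_qubits L n k t) (\<lambda>_ s t. of_bool (s = t))"
    proof (rule ext, rule ext)
      fix x y
      show "?E t x y = tensor2 (level_qubits L n k t) (\<lambda>_ s t. of_bool (s = t)) x y"
        unfolding encoding_self by (cases x, cases y) (auto simp: kron_def tensor1_I tensor2_I)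
    qed
    have "op_mult (?A t) U (?E t) = U"
      unfolding E by (rule op_mult_I2_right[where M = U, OF finite_level_qubits right])
    moreover have "op_mult (?A t) (?E t) U = U"
      unfolding E by (rule op_mult_I2_left[where M = U, OF finite_level_qubits left])
    ultimately show "equal_on_encoded (?A t) (?A t) (?E t) U U"
      by (intro equal_on_encoded_refl) (simp only:)
  next
    fix u
    assume "t \<le> u"
    then show "?E (Suc u) = op_mult (?A u) (?E u) (kron (block_encoding L n k V (Suc u)) (block_encoding L n k V (Suc u)))"
      by (simp only: encoding_Suc kron_op_mult)
  next
    fix u U
    assume u: "t \<le> u" "u < l" and "U \<in> two_block_ops L n k P \<G> (Suc u)"
    then show "\<exists>U'\<in>two_block_ops L n k P \<G> u. equal_on_encoded (?A u) (?A (Suc u))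
        (kron (block_encoding L n k V (Suc u)) (block_encoding L n k V (Suc u))) U' U"
      using t by (intro two_block_step P vanish step) auto
  qed
  then obtain G where G: "G \<in> gate_family P \<G> (\<lambda>s t. of_bool (s = t)) (level_qubits L n k t)"
    and eq: "equal_on_encoded (?A t) (?A l) (?E l) (tensor2 (level_qubits L n k t) G) U"
    unfolding two_block_ops_def by blast
  have "unitary_gate (G q)" if "q \<in> level_qubits L n k t" for q
    using G that unitary[of "G q"] unitary_identity2 by (cases "P q") (auto simp: gate_family_def)
  then show ?thesis
    unfolding transversal_two_def using eq by blast
qed


section \<open>Multilevel transversality\<close>

theorem theorem3:
  fixes L N K dist l m :: nat
    and n k d j i :: "nat \<Rightarrow> nat"
    and D :: "nat \<Rightarrow> bit vec set"
    and G :: "nat \<Rightarrow> bit mat"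
    and h :: "nat \<Rightarrow> nat \<Rightarrow> bit vec"
    and X Z :: "nat \<Rightarrow> nat \<Rightarrow> (nat set, nat set) op"
    and V :: "nat \<Rightarrow> (nat set, nat set) op"
  defines "B \<equiv> (\<lambda>p. if p \<le> m then {j p} else {1..k p})"
    and "A \<equiv> (\<lambda>p. {i p})"
  assumes code: "\<And>p. p \<in> {1..L} \<Longrightarrow> self_dual_css_code (n p) (k p) (d p) (D p) (G p)"
    and k_pos: "\<And>p. p \<in> {1..L} \<Longrightarrow> k p \<ge> 1"
    and proper: "\<And>p. p \<in> {1..L} \<Longrightarrow> dual_code (n p) (D p) \<subset> D p"
    and h_carrier: "\<And>p t. p \<in> {1..L} \<Longrightarrow> t \<in> {1..k p} \<Longrightarrow> h p t \<in> carrier_vec (n p)"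
    and h_span: "\<And>p. p \<in> {1..L} \<Longrightarrow>
      D p = vec_span (n p) (dual_code (n p) (D p) \<union> h p ` {1..k p})"
    and h_odd: "\<And>p. p \<in> {1..L} \<Longrightarrow> \<exists>t\<in>{1..k p}. h p t \<bullet> h p t = 1"
    and compatible: "\<And>p. p \<in> {1..L} \<Longrightarrow>
      compatible_basis (n p) (k p) (css_stabilizer (n p) (G p)) (X p) (Z p) (V p)"
    and params: "N = (\<Prod>p\<in>{1..L}. n p)" "K = (\<Prod>p\<in>{1..L}. k p)"
      "dist = concatenated_distance L n k V"
    and levels: "l \<in> {0..L}" "m \<in> {0..L}" "m < l"
    and j_range: "\<And>p. p \<in> {1..m} \<Longrightarrow> j p \<in> {1..k p}"
    and i_range: "\<And>p. p \<in> {l + 1..L} \<Longrightarrow> i p \<in> {1..n p}"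
  shows "\<forall>t\<in>{m..l}.
      transversal_one L n k V l t (U_H L n k l B A)
      \<and> (\<forall>a \<in> index_box L l B A \<rightarrow> {1, - 1}. transversal_one L n k V l t (U_S L n k l B A a))
      \<and> transversal_two L n k V l t (U_CNOT L n k l B A)"
proof -
  let ?Q = "\<lambda>p. {1..n p}" and ?K = "\<lambda>p. {1..k p}"
  \<comment> \<open>Only the fixed coordinates are constrained, so the same \<open>P\<close> selects
    qubits at every level from \<open>m\<close> to \<open>l\<close>, whatever their coordinates in
    \<open>m + 1..l\<close> are.\<close>
  define P where "P q \<longleftrightarrow> (\<forall>p\<in>{1..m}. q p = j p) \<and> (\<forall>p\<in>{l + 1..L}. q p = i p)" for q :: "nat \<Rightarrow> nat"
  have P_update: "P (q(p := v)) = P q" if "p \<in> {t<..l}" "m \<le> t" for p t q v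
    using that by (auto simp: P_def)
  have box: "q \<in> index_box L l B A \<longleftrightarrow> P q" if q: "q \<in> level_qubits L n k l" for q
  proof
    assume "q \<in> index_box L l B A"
    then have mem: "q p \<in> (if p \<le> l then B p else A p)" if "p \<in> {1..L}" for p
      using that unfolding index_box_def by (rule PiE_mem)
    show "P q"
      unfolding P_def
    proof (intro conjI ballI)
      show "q p = j p" if "p \<in> {1..m}" for p
        using mem[of p] levels that by (simp add: B_def)
      show "q p = i p" if "p \<in> {l + 1..L}" for p
        using mem[of p] that by (simp add: A_def)
    qed
  next
    assume P: "P q"
    have "q p \<in> (if p \<le> l then B p else A p)" if p: "p \<in> {1..L}" for p
      using PiE_mem[OF q[unfolded level_qubits_eq] p] P p levels
      unfolding P_def A_def B_def by (cases "p \<le> l") simp_all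
    moreover have "q p = undefined" if "p \<notin> {1..L}" for p
      using q that unfolding level_qubits_eq by (rule PiE_arb)
    ultimately show "q \<in> index_box L l B A"
      unfolding index_box_def by (rule PiE_I)
  qed
  have enc: "compatible_encoding (?Q p) (?K p) (check_supports (n p) (G p)) (V p)" if "p \<in> {1..L}" for p
    using compatible[OF that] by (rule compatible_basis_encoding)
  have vanish: "V p x y = 0" if "p \<in> {1..L}" "\<not> (x \<subseteq> ?Q p \<and> y \<subseteq> ?K p)" for p x y
    using compatible_encoding.vanish[OF enc[OF that(1)] that(2)] .
  show ?thesis
  proof (intro ballI conjI)
    fix t
    assume "t \<in> {m..l}"
    then have t: "t \<le> l" "l \<le> L" "m \<le> t"
      using levels by auto
    note P_t = P_update[OF _ t(3)]
    show "transversal_one L n k V l t (U_H L n k l B A)"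
    \<comment> \<open>Compatibility sends the Hadamard gate to itself, so a class with one element
      is closed.\<close>
    proof (rule descend_one[where \<G> = "{gate_H}" and P = P, OF t(1,2) P_t vanish])
      fix p and g :: "nat \<Rightarrow> gate1"
      assume p: "p \<in> {1..L}" and "g \<in> ?K p \<rightarrow> {gate_H}"
      then have g: "tensor1 (?K p) g = tensor1 (?K p) (\<lambda>_. gate_H)"
        by (intro tensor1_cong) auto
      show "\<exists>g'\<in>?Q p \<rightarrow> {gate_H}. equal_on_encoded (Pow (?Q p)) (Pow (?K p)) (V p)
          (tensor1 (?Q p) g') (tensor1 (?K p) g)"
        unfolding g using compatible_encoding.hadamard[OF enc[OF p]]
        by (intro bexI[of _ "\<lambda>_. gate_H"]) simp_all
    next
      show "U_H L n k l B A \<in> one_block_ops L n k P {gate_H} l"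
        unfolding U_H_def one_block_ops_def by (intro imageI) (simp add: gate_family_def box)
    qed (simp_all add: unitary_gate_H)
    show "transversal_one L n k V l t (U_S L n k l B A a)" if a: "a \<in> index_box L l B A \<rightarrow> {1, - 1}" for a
    \<comment> \<open>The physical signs \<open>b\<close> depend on the logical signs
      \<open>c\<close>, so the class needs both the phase gate and its inverse, chosen freely on
      each qubit.\<close>
    proof (rule descend_one[where \<G> = "gate_S ` {- 1, 1}" and P = P, OF t(1,2) P_t vanish])
      fix p and g :: "nat \<Rightarrow> gate1"
      assume p: "p \<in> {1..L}" and g: "g \<in> ?K p \<rightarrow> gate_S ` {- 1, 1}"
      then have "\<forall>q\<in>?K p. \<exists>c. c \<in> {- 1, 1} \<and> g q = gate_S c"
        by blast
      then obtain c where c: "\<forall>q\<in>?K p. c q \<in> {- 1, 1} \<and> g q = gate_S (c q)"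
        by (rule bchoice[THEN exE])
      then have g_eq: "tensor1 (?K p) g = tensor1 (?K p) (\<lambda>q. gate_S (c q))"
        by (intro tensor1_cong) blast
      have "c \<in> ?K p \<rightarrow> {- 1, 1}"
        using c by blast
      then obtain b where "b \<in> ?Q p \<rightarrow> {- 1, 1}"
        and "equal_on_encoded (Pow (?Q p)) (Pow (?K p)) (V p)
          (tensor1 (?Q p) (\<lambda>q. gate_S (b q))) (tensor1 (?K p) g)"
        unfolding g_eq using compatible_encoding.phase[OF enc[OF p]] by blast
      then show "\<exists>g'\<in>?Q p \<rightarrow> gate_S ` {- 1, 1}. equal_on_encoded (Pow (?Q p)) (Pow (?K p)) (V p)
          (tensor1 (?Q p) g') (tensor1 (?K p) g)"
        by (intro bexI[of _ "\<lambda>q. gate_S (b q)"]) blast+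
    next
      show "U_S L n k l B A a \<in> one_block_ops L n k P (gate_S ` {- 1, 1}) l"
        unfolding U_S_def one_block_ops_def
      proof (rule imageI)
        have "gate_S (a q) \<in> gate_S ` {- 1, 1}" if "q \<in> index_box L l B A" for q
          using a that by blast
        then show "(\<lambda>q. if q \<in> index_box L l B A then gate_S (a q) else gate_I)
            \<in> gate_family P (gate_S ` {- 1, 1}) gate_I (level_qubits L n k l)"
          unfolding gate_family_def by (simp add: box del: image_insert)
      qed
    qed (auto intro: unitary_gate_S)
    \<comment> \<open>All four Pauli-corrected CNOT gates: the descent starts at the plain one and
      may reach the others after one level.\<close>
    let ?C = "range (\<lambda>(a, b). pauli_CNOT a b)"
    show "transversal_two L n k V l t (U_CNOT L n k l B A)"
    proof (rule descend_two[where \<G> = ?C and P = P, OF t(1,2) P_t vanish])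
      fix p and g :: "nat \<Rightarrow> gate2"
      assume p: "p \<in> {1..L}" and g: "g \<in> ?K p \<rightarrow> ?C"
      then have "\<forall>q\<in>?K p. \<exists>c. g q = pauli_CNOT (fst c) (snd c)"
        by (force simp: Pi_iff)
      then obtain c where c: "\<forall>q\<in>?K p. g q = pauli_CNOT (fst (c q)) (snd (c q))"
        by (rule bchoice[THEN exE])
      define \<alpha> where "\<alpha> = {q \<in> ?K p. fst (c q)}"
      define \<beta> where "\<beta> = {q \<in> ?K p. snd (c q)}"
      have g_eq: "tensor2 (?K p) g = tensor2 (?K p) (\<lambda>q. pauli_CNOT (q \<in> \<alpha>) (q \<in> \<beta>))"
        using c by (intro tensor2_cong) (simp add: \<alpha>_def \<beta>_def)
      have "\<alpha> \<subseteq> ?K p" "\<beta> \<subseteq> ?K p"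
        unfolding \<alpha>_def \<beta>_def by blast+
      then obtain \<alpha>' \<beta>' where "equal_on_encoded (Pow (?Q p) \<times> Pow (?Q p)) (Pow (?K p) \<times> Pow (?K p))
          (kron (V p) (V p)) (tensor2 (?Q p) (\<lambda>q. pauli_CNOT (q \<in> \<alpha>') (q \<in> \<beta>'))) (tensor2 (?K p) g)"
        unfolding g_eq using compatible_encoding.transversal_pauli_CNOT[OF enc[OF p]] by blast
      then show "\<exists>g'\<in>?Q p \<rightarrow> ?C. equal_on_encoded (Pow (?Q p) \<times> Pow (?Q p)) (Pow (?K p) \<times> Pow (?K p))
          (kron (V p) (V p)) (tensor2 (?Q p) g') (tensor2 (?K p) g)"
        by (rule bexI[of _ "\<lambda>q. pauli_CNOT (q \<in> \<alpha>') (q \<in> \<beta>')"]) auto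
    next
      show "U_CNOT L n k l B A \<in> two_block_ops L n k P ?C l"
        unfolding U_CNOT_def two_block_ops_def gate_CNOT_eq
        by (intro imageI) (auto simp: gate_family_def box)
    qed (auto intro: unitary_pauli_CNOT)
  qed
qed

end
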